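(* Let $T$ be a self-adjoint and boundedly invertible operator in the Hilbert space $(H,(\cdot,\cdot))$. Then the form $(T\cdot,\cdot)$ on $\operatorname{dom}T$ has a unique closure in $(H,(\cdot,\cdot))$ (i.e. the sets $\mathcal M_T$ and $\mathcal N_T$ both have only one element) if and only if the operator $T$ is semibounded.
   Context: All spaces are complex; sesquilinear forms are linear in the first argument. "Boundedly invertible" means having an everywhere defined bounded inverse. "Semibounded" means semibounded from below or from above. $(K,[\cdot,\cdot])$ is a Krein space if $K=K^+\oplus K^-$ (direct, $[\cdot,\cdot]$-orthogonal) with $(K^+,[\cdot,\cdot])$ and $(K^-,-[\cdot,\cdot])$ Hilbert spaces. With the projections $P^\pm$ onto $K^\pm$, $J:=P^+-P^-$ is a fundamental symmetry and $[J\cdot,\cdot]$ is a Hilbert space inner product on $K$; its topology (independent of $J$) is the topology of $K$. A Krein space $(K,[\cdot,\cdot])$ is a Krein space completion of an inner product space if the latter is a dense subspace of $K$ on which the two inner products coincide. A form is a densely defined symmetric sesquilinear form $\mathfrak t[\cdot,\cdot]$ in $(H,(\cdot,\cdot))$. Put $\mathfrak t_\lambda[\cdot,\cdot]:=\mathfrak t[\cdot,\cdot]-\lambda(\cdot,\cdot)$. It is closed if for some $\lambda\in\mathbb R$ (a gap point) $(\operatorname{dom}\mathfrak t,\mathfrak t_\lambda[\cdot,\cdot])$ is a Krein space continuously embedded in $(H,(\cdot,\cdot))$. A closed extension $\mathfrak t$ of a form $\tilde{\mathfrak t}$ is a closure of $\tilde{\mathfrak t}$ if $\operatorname{dom}\tilde{\mathfrak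 t}$ is dense in the Krein space $(\operatorname{dom}\mathfrak t,\mathfrak t_\lambda[\cdot,\cdot])$ for some gap point $\lambda$. $\mathcal M_T$ is the set of all closures of the form $(T\cdot,\cdot)$ (defined on $\operatorname{dom}T$) in $(H,(\cdot,\cdot))$. $\mathcal N_T$ is the set of all triples $(K,[\cdot,\cdot],A)$ where $(K,[\cdot,\cdot])$ is a Krein space completion of $(\operatorname{dom}T,(T\cdot,\cdot))$ continuously embedded in $(H,(\cdot,\cdot))$ and $A=T|_{\operatorname{dom}A}$ with $\operatorname{dom}A=T^{-1}(K)$. *)

theory Defs
  imports "HOL-Analysis.Analysis"
begin

section \<open>Complex Hilbert spaces\<close>

text \<open>The topology, the norm and the completeness are those of class banach. Positive
  definiteness of cinner follows from the last axiom and the norm axioms.\<close>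

class complex_hilbert = banach +
  fixes scaleC :: "complex \<Rightarrow> 'a \<Rightarrow> 'a"  (infixr \<open>*\<^sub>C\<close> 75)
    and cinner :: "'a \<Rightarrow> 'a \<Rightarrow> complex"
  assumes scaleC_add_right: "a *\<^sub>C (x + y) = a *\<^sub>C x + a *\<^sub>C y"
    and scaleC_add_left: "(a + b) *\<^sub>C x = a *\<^sub>C x + b *\<^sub>C x"
    and scaleC_scaleC: "a *\<^sub>C b *\<^sub>C x = (a * b) *\<^sub>C x"
    and scaleC_of_real: "complex_of_real r *\<^sub>C x = r *\<^sub>R x"
    and cinner_add_left: "cinner (x + y) z = cinner x z + cinner y z"
    and cinner_scaleC_left: "cinner (a *\<^sub>C x) y = a * cinner x y"
    and cinner_commute: "cinner y x = cnj (cinner x y)"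
    and norm_power2_eq_cinner: "(norm x)\<^sup>2 = Re (cinner x x)"

global_interpretation complex_vector: vector_space "(*\<^sub>C) :: complex \<Rightarrow> 'a \<Rightarrow> 'a::complex_hilbert"
  defines csubspace = complex_vector.subspace
proof unfold_locales
  show "1 *\<^sub>C x = x" for x :: 'a
    using scaleC_of_real[of 1 x] by simp
qed (simp_all add: scaleC_add_right scaleC_add_left scaleC_scaleC)


section \<open>Krein spaces\<close>

text \<open>All spaces in question are linear subspaces of the ambient space, with an inner product of
  their own, possibly indefinite, that is only looked at on the subspace.\<close>

definition hermitian_on :: "'a::complex_hilbert set \<Rightarrow> ('a \<Rightarrow> 'a \<Rightarrow> complex) \<Rightarrow> bool" where
  "hermitian_on V ip \<longleftrightarrow>
     (\<forall>x\<in>V. \<forall>y\<in>V. \<forall>z\<in>V. ip (x + y) z = ip x z + ip y z) \<and>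
     (\<forall>a. \<forall>x\<in>V. \<forall>y\<in>V. ip (a *\<^sub>C x) y = a * ip x y) \<and>
     (\<forall>x\<in>V. \<forall>y\<in>V. ip y x = cnj (ip x y))"

text \<open>The locale Metric_space asks for nonnegativity and symmetry of the distance on the whole type,
  hence the value 0 off V.\<close>

definition ip_dist ::
    "'a::complex_hilbert set \<Rightarrow> ('a \<Rightarrow> 'a \<Rightarrow> complex) \<Rightarrow> 'a \<Rightarrow> 'a \<Rightarrow> real" where
  "ip_dist V ip x y = (if x \<in> V \<and> y \<in> V then sqrt (Re (ip (x - y) (x - y))) else 0)"

definition hilbert_on :: "'a::complex_hilbert set \<Rightarrow> ('a \<Rightarrow> 'a \<Rightarrow> complex) \<Rightarrow> bool" where
  "hilbert_on V ip \<longleftrightarrow> csubspace V \<and> hermitian_on V ip \<and>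
     (\<forall>x\<in>V. x \<noteq> 0 \<longrightarrow> 0 < Re (ip x x)) \<and> Metric_space.mcomplete V (ip_dist V ip)"

definition fundamental_decomposition ::
    "'a::complex_hilbert set \<Rightarrow> ('a \<Rightarrow> 'a \<Rightarrow> complex) \<Rightarrow> 'a set \<Rightarrow> 'a set \<Rightarrow> bool" where
  "fundamental_decomposition K ip Kp Km \<longleftrightarrow>
     hilbert_on Kp ip \<and> hilbert_on Km (\<lambda>x y. - ip x y) \<and>
     K = {x + y |x y. x \<in> Kp \<and> y \<in> Km} \<and> Kp \<inter> Km = {0} \<and>
     (\<forall>x\<in>Kp. \<forall>y\<in>Km. ip x y = 0)"

definition krein_space :: "'a::complex_hilbert set \<Rightarrow> ('a \<Rightarrow> 'a \<Rightarrow> complex) \<Rightarrow> bool" where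
  "krein_space K ip \<longleftrightarrow> csubspace K \<and> hermitian_on K ip \<and>
     (\<exists>Kp Km. fundamental_decomposition K ip Kp Km)"

text \<open>Values of a fundamental symmetry outside K are irrelevant.\<close>

definition fundamental_symmetry ::
    "'a::complex_hilbert set \<Rightarrow> ('a \<Rightarrow> 'a \<Rightarrow> complex) \<Rightarrow> ('a \<Rightarrow> 'a) \<Rightarrow> bool" where
  "fundamental_symmetry K ip J \<longleftrightarrow>
     (\<exists>Kp Km. fundamental_decomposition K ip Kp Km \<and> (\<forall>x\<in>Kp. \<forall>y\<in>Km. J (x + y) = x - y))"

text \<open>The topology of a Krein space does not depend on the fundamental symmetry, so the choice
  made here is immaterial.\<close>

definition krein_topology ::
    "'a::complex_hilbert set \<Rightarrow> ('a \<Rightarrow> 'a \<Rightarrow> complex) \<Rightarrow> 'a topology" where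
  "krein_topology K ip =
     (let J = (SOME J. fundamental_symmetry K ip J)
      in Metric_space.mtopology K (ip_dist K (\<lambda>x y. ip (J x) y)))"

definition continuously_embedded ::
    "'a::complex_hilbert set \<Rightarrow> ('a \<Rightarrow> 'a \<Rightarrow> complex) \<Rightarrow> bool" where
  "continuously_embedded K ip \<longleftrightarrow> continuous_map (krein_topology K ip) euclidean (\<lambda>x. x)"

definition krein_completion :: "'a::complex_hilbert set \<Rightarrow> ('a \<Rightarrow> 'a \<Rightarrow> complex) \<Rightarrow>
    'a set \<Rightarrow> ('a \<Rightarrow> 'a \<Rightarrow> complex) \<Rightarrow> bool" where
  "krein_completion D ip' K ip \<longleftrightarrow> krein_space K ip \<and> csubspace D \<and> D \<subseteq> K \<and>
     krein_topology K ip closure_of D = K \<and> (\<forall>x\<in>D. \<forall>y\<in>D. ip x y = ip' x y)"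


section \<open>Forms\<close>

text \<open>A form is a domain together with a function that is set to 0 where one of the arguments
  is outside the domain. Hence equal forms are represented by equal pairs.\<close>

type_synonym 'a form = "'a set \<times> ('a \<Rightarrow> 'a \<Rightarrow> complex)"

definition zero_outside :: "'a set \<Rightarrow> ('a \<Rightarrow> 'a \<Rightarrow> complex) \<Rightarrow> bool" where
  "zero_outside D t \<longleftrightarrow> (\<forall>x y. x \<notin> D \<or> y \<notin> D \<longrightarrow> t x y = 0)"

definition is_form :: "'a::complex_hilbert form \<Rightarrow> bool" where
  "is_form = (\<lambda>(D, t). csubspace D \<and> closure D = UNIV \<and> hermitian_on D t \<and> zero_outside D t)"

definition shift_form :: "real \<Rightarrow> ('a::complex_hilbert \<Rightarrow> 'a \<Rightarrow> complex) \<Rightarrow> 'a \<Rightarrow> 'a \<Rightarrow> complex" where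
  "shift_form l t = (\<lambda>x y. t x y - complex_of_real l * cinner x y)"

definition gap_point :: "'a::complex_hilbert form \<Rightarrow> real \<Rightarrow> bool" where
  "gap_point = (\<lambda>(D, t) l. krein_space D (shift_form l t) \<and>
     continuously_embedded D (shift_form l t))"

definition closed_form :: "'a::complex_hilbert form \<Rightarrow> bool" where
  "closed_form t \<longleftrightarrow> is_form t \<and> (\<exists>l. gap_point t l)"

definition form_extends :: "'a form \<Rightarrow> 'a form \<Rightarrow> bool" where
  "form_extends = (\<lambda>(D', t') (D, t). D' \<subseteq> D \<and> (\<forall>x\<in>D'. \<forall>y\<in>D'. t x y = t' x y))"

definition form_closure :: "'a::complex_hilbert form \<Rightarrow> 'a form \<Rightarrow> bool" where
  "form_closure t' t \<longleftrightarrow> closed_form t \<and> form_extends t' t \<and>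
     (\<exists>l. gap_point t l \<and> krein_topology (fst t) (shift_form l (snd t)) closure_of (fst t') = fst t)"


section \<open>Operators\<close>

text \<open>Operators are partial maps.\<close>

definition linear_operator :: "('a::complex_hilbert \<rightharpoonup> 'a) \<Rightarrow> bool" where
  "linear_operator T \<longleftrightarrow> csubspace (dom T) \<and>
     (\<forall>x\<in>dom T. \<forall>y\<in>dom T. the (T (x + y)) = the (T x) + the (T y)) \<and>
     (\<forall>a. \<forall>x\<in>dom T. the (T (a *\<^sub>C x)) = a *\<^sub>C the (T x))"

text \<open>Meaningful for densely defined operators only, where the element z is unique.\<close>

definition adjoint_operator :: "('a::complex_hilbert \<rightharpoonup> 'a) \<Rightarrow> ('a \<rightharpoonup> 'a)" where
  "adjoint_operator T = (\<lambda>y.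
     if \<exists>z. \<forall>x\<in>dom T. cinner (the (T x)) y = cinner x z
     then Some (THE z. \<forall>x\<in>dom T. cinner (the (T x)) y = cinner x z)
     else None)"

definition self_adjoint :: "('a::complex_hilbert \<rightharpoonup> 'a) \<Rightarrow> bool" where
  "self_adjoint T \<longleftrightarrow> linear_operator T \<and> closure (dom T) = UNIV \<and> adjoint_operator T = T"

definition boundedly_invertible :: "('a::complex_hilbert \<rightharpoonup> 'a) \<Rightarrow> bool" where
  "boundedly_invertible T \<longleftrightarrow> bij_betw (\<lambda>x. the (T x)) (dom T) UNIV \<and>
     bounded_linear (inv_into (dom T) (\<lambda>x. the (T x)))"

definition semibounded_below :: "('a::complex_hilbert \<rightharpoonup> 'a) \<Rightarrow> bool" where
  "semibounded_below T \<longleftrightarrow> (\<exists>c. \<forall>x\<in>dom T. c * (norm x)\<^sup>2 \<le> Re (cinner (the (T x)) x))"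

definition semibounded_above :: "('a::complex_hilbert \<rightharpoonup> 'a) \<Rightarrow> bool" where
  "semibounded_above T \<longleftrightarrow> (\<exists>c. \<forall>x\<in>dom T. Re (cinner (the (T x)) x) \<le> c * (norm x)\<^sup>2)"

definition semibounded :: "('a::complex_hilbert \<rightharpoonup> 'a) \<Rightarrow> bool" where
  "semibounded T \<longleftrightarrow> semibounded_below T \<or> semibounded_above T"

definition operator_form :: "('a::complex_hilbert \<rightharpoonup> 'a) \<Rightarrow> 'a form" where
  "operator_form T =
     (dom T, \<lambda>x y. if x \<in> dom T \<and> y \<in> dom T then cinner (the (T x)) y else 0)"

definition closures_of_operator_form :: "('a::complex_hilbert \<rightharpoonup> 'a) \<Rightarrow> 'a form set"
    (\<open>\<M>\<close>) where
  "\<M> T = {t. form_closure (operator_form T) t}"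

text \<open>As for forms, zero_outside only makes equal inner products equal as functions.\<close>

definition completions_of_operator_form ::
    "('a::complex_hilbert \<rightharpoonup> 'a) \<Rightarrow> ('a set \<times> ('a \<Rightarrow> 'a \<Rightarrow> complex) \<times> ('a \<rightharpoonup> 'a)) set"
    (\<open>\<N>\<close>) where
  "\<N> T = {(K, ip, A).
     krein_completion (dom T) (snd (operator_form T)) K ip \<and> zero_outside K ip \<and>
     continuously_embedded K ip \<and>
     A = T |` {x \<in> dom T. the (T x) \<in> K}}"

end

theory Submission
  imports Defs
begin

text \<open>Put S for the inverse of T. A Krein space K with form \<open>ip\<close> that contains
  \<open>dom T\<close> and satisfies \<open>ip (S u) y = cinner u y\<close> is a completion, whatever its fundamental
  symmetry. Such spaces arise as ranges of injective operators V with \<open>S = V J V*\<close>, where J is a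
  self-adjoint involution; V may be taken as the square root Q of the modulus of S, and J as the sign of S.

  If T is not semibounded, there are orthonormal sequences in both eigenspaces of J on which Q decays
  rapidly. They are paired to a nilpotent operator N, unbounded but with \<open>Q (1 + N)\<close> bounded, such that
  \<open>1 + N\<close> preserves the form of J. So \<open>V = Q (1 + N)\<close> gives a second completion.

  If T is semibounded, then for suitable \<open>\<sigma> = \<plusminus>1\<close> and large c the operator \<open>B = \<sigma> T + c\<close> is
  positive with a bounded inverse, and on \<open>dom T\<close> the norm of any closure is equivalent to the form
  norm of B. So every closure is the completion of \<open>dom T\<close> in H with respect to that norm.\<close>

section \<open>Hermitian forms on subspaces\<close>

text \<open>A completion is a closure with gap point 0. So existence passes from \<open>\<N>\<close>
  to \<open>\<M>\<close>, uniqueness passes back, and two completions with different spaces refute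
  uniqueness in both. Hence only completions are constructed, while the uniqueness argument has to
  cover closures with an arbitrary gap point.

  Both missing bounds of T are used at once. The operator N pairs vectors that mix the two
  eigenspaces of J, and the decay of Q on each side lets N grow. Growth is essential: N squares to
  zero, so 1 - N inverts 1 + N, and a bounded N would leave the range of Q (1 + N) equal to the
  range of Q. The factor \<i> in N makes J N skew, so that the terms linear in N cancel in the form
  of J.

  The commutation relations behind the factorization of S come from the square roots being limits of
  polynomials in the given operator.\<close>

locale hermitian_form =
  fixes V :: "'a::complex_hilbert set" and h :: "'a \<Rightarrow> 'a \<Rightarrow> complex"
  assumes subspace_V: "csubspace V" and hermitian: "hermitian_on V h"
begin

lemma zero_in [simp]: "0 \<in> V"
  by (rule complex_vector.subspace_0[OF subspace_V])

lemma add_in [simp]: "x \<in> V \<Longrightarrow> y \<in> V \<Longrightarrow> x + y \<in> V"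
  by (rule complex_vector.subspace_add[OF subspace_V])

lemma diff_in [simp]: "x \<in> V \<Longrightarrow> y \<in> V \<Longrightarrow> x - y \<in> V"
  by (rule complex_vector.subspace_diff[OF subspace_V])

lemma scaleC_in [simp]: "x \<in> V \<Longrightarrow> a *\<^sub>C x \<in> V"
  by (rule complex_vector.subspace_scale[OF subspace_V])

lemma scaleR_in [simp]: "x \<in> V \<Longrightarrow> r *\<^sub>R x \<in> V"
  by (metis scaleC_in scaleC_of_real)

lemma minus_in [simp]: "x \<in> V \<Longrightarrow> - x \<in> V"
  by (rule complex_vector.subspace_neg[OF subspace_V])

lemma add_left: "x \<in> V \<Longrightarrow> y \<in> V \<Longrightarrow> z \<in> V \<Longrightarrow> h (x + y) z = h x z + h y z"
  using hermitian unfolding hermitian_on_def by blast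

lemma scaleC_left: "x \<in> V \<Longrightarrow> y \<in> V \<Longrightarrow> h (a *\<^sub>C x) y = a * h x y"
  using hermitian unfolding hermitian_on_def by blast

lemma commute: "x \<in> V \<Longrightarrow> y \<in> V \<Longrightarrow> h y x = cnj (h x y)"
  using hermitian unfolding hermitian_on_def by blast

lemma add_right: "x \<in> V \<Longrightarrow> y \<in> V \<Longrightarrow> z \<in> V \<Longrightarrow> h z (x + y) = h z x + h z y"
  by (metis add_in add_left commute complex_cnj_add)

lemma scaleC_right: "x \<in> V \<Longrightarrow> y \<in> V \<Longrightarrow> h x (a *\<^sub>C y) = cnj a * h x y"
  by (metis scaleC_in scaleC_left commute complex_cnj_mult)

lemma scaleR_left: "x \<in> V \<Longrightarrow> y \<in> V \<Longrightarrow> h (r *\<^sub>R x) y = of_real r * h x y"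
  by (metis scaleC_left scaleC_of_real)

lemma scaleR_right: "x \<in> V \<Longrightarrow> y \<in> V \<Longrightarrow> h x (r *\<^sub>R y) = of_real r * h x y"
  by (metis scaleC_right scaleC_of_real complex_cnj_complex_of_real)

lemma minus_left: "x \<in> V \<Longrightarrow> y \<in> V \<Longrightarrow> h (- x) y = - h x y"
  using scaleR_left[of x y "-1"] by simp

lemma minus_right: "x \<in> V \<Longrightarrow> y \<in> V \<Longrightarrow> h x (- y) = - h x y"
  using scaleR_right[of x y "-1"] by simp

lemma diff_left: "x \<in> V \<Longrightarrow> y \<in> V \<Longrightarrow> z \<in> V \<Longrightarrow> h (x - y) z = h x z - h y z"
  using add_left[of x "- y" z] by (simp add: minus_left)

lemma diff_right: "x \<in> V \<Longrightarrow> y \<in> V \<Longrightarrow> z \<in> V \<Longrightarrow> h z (x - y) = h z x - h z y"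
  using add_right[of x "- y" z] by (simp add: minus_right)

lemma zero_left [simp]: "x \<in> V \<Longrightarrow> h 0 x = 0"
  using scaleR_left[of x x 0] by simp

lemma zero_right [simp]: "x \<in> V \<Longrightarrow> h x 0 = 0"
  using scaleR_right[of x x 0] by simp

lemmas expand = add_left add_right diff_left diff_right minus_left minus_right
  scaleC_left scaleC_right scaleR_left scaleR_right

text \<open>Taking the coefficient of \<open>y\<close> as a real multiple of \<open>h x y\<close>
  makes both cross terms equal and real, leaving a real quadratic in \<open>t\<close>. The
  Cauchy-Schwarz inequality and the orthogonality of a nearest point are both read off from
  it.\<close>

lemma Re_diagonal_diff:
  assumes x: "x \<in> V" and y: "y \<in> V"
  shows "Re (h (x - (of_real t * h x y) *\<^sub>C y) (x - (of_real t * h x y) *\<^sub>C y))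
       = Re (h x x) - 2 * t * (cmod (h x y))\<^sup>2 + t\<^sup>2 * (cmod (h x y))\<^sup>2 * Re (h y y)"
proof -
  define a where "a = h x y"
  have yx: "h y x = cnj a" using commute[OF x y] by (simp add: a_def)
  define b where "b = of_real t * a"
  have "h (x - b *\<^sub>C y) (x - b *\<^sub>C y) = h x x - (cnj b * h x y + b * h y x) + (b * cnj b) * h y y"
  proof -
    have "h (x - b *\<^sub>C y) (x - b *\<^sub>C y) = h x x - cnj b * h x y - (b * h y x - b * (cnj b * h y y))"
      using x y by (simp add: diff_left diff_right scaleC_left scaleC_right right_diff_distrib)
    then show ?thesis by (simp add: algebra_simps)
  qed
  also have "cnj b * h x y + b * h y x = of_real (2 * t) * (a * cnj a)"
    unfolding yx by (simp add: b_def a_def[symmetric])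
  also have "a * cnj a = of_real ((cmod a)\<^sup>2)" using complex_norm_square[of a] by simp
  also have "b * cnj b = of_real (t\<^sup>2 * (cmod a)\<^sup>2)"
    using complex_norm_square[of a] by (simp add: b_def power2_eq_square)
  finally have "Re (h (x - b *\<^sub>C y) (x - b *\<^sub>C y))
     = Re (h x x) - 2 * t * (cmod a)\<^sup>2 + t\<^sup>2 * (cmod a)\<^sup>2 * Re (h y y)"
    by (simp only: of_real_mult[symmetric] plus_complex.simps minus_complex.simps Re_complex_of_real Re_complex_of_real times_complex.simps Im_complex_of_real)
  then show ?thesis by (simp add: b_def a_def)
qed

end

section \<open>Semidefinite forms and their seminorms\<close>

locale semidefinite_form = hermitian_form +
  assumes nonneg: "x \<in> V \<Longrightarrow> 0 \<le> Re (h x x)"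
begin

definition hnorm :: "'a \<Rightarrow> real" where "hnorm x = sqrt (Re (h x x))"

lemma hnorm_power2: "x \<in> V \<Longrightarrow> (hnorm x)\<^sup>2 = Re (h x x)"
  by (simp add: hnorm_def nonneg)

lemma hnorm_nonneg [simp]: "x \<in> V \<Longrightarrow> 0 \<le> hnorm x"
  by (simp add: hnorm_def nonneg)

text \<open>The quadratic in \<open>t\<close> is nonnegative and is tested at its minimum
  \<open>1 / Re (h y y)\<close>. If \<open>Re (h y y)\<close> vanishes it is affine in
  \<open>t\<close>, and a nonzero slope would make it negative for large \<open>t\<close>.\<close>

lemma Cauchy_Schwarz_power2:
  assumes x: "x \<in> V" and y: "y \<in> V"
  shows "(cmod (h x y))\<^sup>2 \<le> Re (h x x) * Re (h y y)"
proof -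
  define a where "a = h x y"
  have q: "0 \<le> Re (h x x) - 2 * t * (cmod a)\<^sup>2 + t\<^sup>2 * (cmod a)\<^sup>2 * Re (h y y)" for t :: real
    using nonneg[of "x - (of_real t * h x y) *\<^sub>C y"] x y
    by (simp add: Re_diagonal_diff a_def)
  show ?thesis
  proof (cases "Re (h y y) = 0")
    case True
    have "a = 0"
    proof (rule ccontr)
      assume "a \<noteq> 0"
      then show False
        using q[of "(Re (h x x) + 1) / (2 * (cmod a)\<^sup>2)"] nonneg[OF x] True by (simp add: field_simps)
    qed
    then show ?thesis using True by (simp add: a_def)
  next
    case False
    then have pos: "0 < Re (h y y)" using nonneg[OF y] by simp
    then show ?thesis
      using q[of "1 / Re (h y y)"] by (simp add: field_simps power2_eq_square flip: a_def)
  qed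
qed

lemma Cauchy_Schwarz: "x \<in> V \<Longrightarrow> y \<in> V \<Longrightarrow> cmod (h x y) \<le> hnorm x * hnorm y"
  by (rule power2_le_imp_le) (simp_all add: power_mult_distrib hnorm_power2 Cauchy_Schwarz_power2)

lemma hnorm_triangle:
  assumes x: "x \<in> V" and y: "y \<in> V" shows "hnorm (x + y) \<le> hnorm x + hnorm y"
proof (rule power2_le_imp_le)
  have "Re (h (x + y) (x + y)) = Re (h x x) + 2 * Re (h x y) + Re (h y y)"
    using x y by (simp add: expand commute[of x y])
  moreover have "Re (h x y) \<le> hnorm x * hnorm y"
    using Cauchy_Schwarz[OF x y] complex_Re_le_cmod order_trans by blast
  ultimately show "(hnorm (x + y))\<^sup>2 \<le> (hnorm x + hnorm y)\<^sup>2"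
    using x y by (simp add: hnorm_power2 power2_sum)
qed (use x y in simp)

lemma hnorm_scaleC: "x \<in> V \<Longrightarrow> hnorm (a *\<^sub>C x) = cmod a * hnorm x"
proof -
  assume x: "x \<in> V"
  have "h (a *\<^sub>C x) (a *\<^sub>C x) = (a * cnj a) * h x x"
    using x by (simp add: expand)
  also have "\<dots> = of_real ((cmod a)\<^sup>2) * h x x" using complex_norm_square[of a] by simp
  finally have "Re (h (a *\<^sub>C x) (a *\<^sub>C x)) = (cmod a)\<^sup>2 * Re (h x x)" by simp
  then show ?thesis by (simp add: hnorm_def real_sqrt_mult)
qed

lemma hnorm_scaleR: "x \<in> V \<Longrightarrow> hnorm (r *\<^sub>R x) = \<bar>r\<bar> * hnorm x"
  by (metis hnorm_scaleC norm_of_real scaleC_of_real)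

lemma hnorm_zero [simp]: "hnorm 0 = 0"
  by (simp add: hnorm_def)

lemma hnorm_minus: "x \<in> V \<Longrightarrow> hnorm (- x) = hnorm x"
  using hnorm_scaleR[of x "-1"] by simp

lemma hnorm_diff_commute: "x \<in> V \<Longrightarrow> y \<in> V \<Longrightarrow> hnorm (x - y) = hnorm (y - x)"
  by (metis diff_in hnorm_minus minus_diff_eq)

lemma parallelogram:
  assumes "x \<in> V" "y \<in> V"
  shows "(hnorm (x + y))\<^sup>2 + (hnorm (x - y))\<^sup>2 = 2 * (hnorm x)\<^sup>2 + 2 * (hnorm y)\<^sup>2"
  using assms by (simp add: hnorm_power2 expand)

end

section \<open>Positive definite forms and their metric\<close>

locale pre_hilbert_form = hermitian_form +
  assumes pos: "x \<in> V \<Longrightarrow> x \<noteq> 0 \<Longrightarrow> 0 < Re (h x x)"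
begin

sublocale semidefinite_form
  by unfold_locales (metis less_eq_real_def pos zero_left zero_complex.simps(1))

lemma hnorm_eq_0_iff [simp]: "x \<in> V \<Longrightarrow> hnorm x = 0 \<longleftrightarrow> x = 0"
  using pos by (force simp: hnorm_def)

lemma ip_dist_eq: "x \<in> V \<Longrightarrow> y \<in> V \<Longrightarrow> ip_dist V h x y = hnorm (x - y)"
  by (simp add: ip_dist_def hnorm_def)

sublocale M: Metric_space V "ip_dist V h"
proof
  show "0 \<le> ip_dist V h x y" for x y
    by (auto simp: ip_dist_def nonneg)
  show "ip_dist V h x y = ip_dist V h y x" for x y
    by (cases "x \<in> V \<and> y \<in> V") (auto simp: ip_dist_eq hnorm_diff_commute, auto simp: ip_dist_def)
  show "ip_dist V h x y = 0 \<longleftrightarrow> x = y" if "x \<in> V" "y \<in> V" for x y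
    using that by (simp add: ip_dist_eq)
  show "ip_dist V h x z \<le> ip_dist V h x y + ip_dist V h y z" if "x \<in> V" "y \<in> V" "z \<in> V" for x y z
    using hnorm_triangle[of "x - y" "y - z"] that by (simp add: ip_dist_eq)
qed

lemma limitin_iff:
  assumes "\<And>n. s n \<in> V"
  shows "limitin M.mtopology s l sequentially \<longleftrightarrow> l \<in> V \<and> (\<lambda>n. hnorm (s n - l)) \<longlonglongrightarrow> 0"
  using assms by (auto simp: M.limitin_metric_dist_null ip_dist_eq)

lemma closure_of_sequence:
  assumes "D \<subseteq> V" "x \<in> M.mtopology closure_of D"
  obtains s where "\<And>n. s n \<in> D" "(\<lambda>n. hnorm (s n - x)) \<longlonglongrightarrow> 0"
proof -
  have xV: "x \<in> V" and ex: "\<And>e. e > 0 \<Longrightarrow> \<exists>y\<in>D. ip_dist V h x y < e"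
    using assms by (auto simp: M.metric_closure_of)
  obtain s where s: "\<And>n. s n \<in> D \<and> ip_dist V h x (s n) < 1 / real (Suc n)"
  proof -
    have "\<forall>n. \<exists>y\<in>D. ip_dist V h x y < 1 / real (Suc n)" using ex by simp
    then show ?thesis using that by metis
  qed
  have "(\<lambda>n. hnorm (s n - x)) \<longlonglongrightarrow> 0"
  proof (rule real_tendsto_sandwich[OF _ _ tendsto_const LIMSEQ_inverse_real_of_nat])
    show "\<forall>\<^sub>F n in sequentially. 0 \<le> hnorm (s n - x)"
      using s xV assms(1) by (intro always_eventually) (simp add: subset_iff)
    show "\<forall>\<^sub>F n in sequentially. hnorm (s n - x) \<le> inverse (real (Suc n))"
      using s xV assms(1) by (intro always_eventually)
        (metis hnorm_diff_commute ip_dist_eq inverse_eq_divide less_imp_le subsetD)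
  qed
  with s that show ?thesis by blast
qed

lemma continuous_embedding_bound:
  assumes "continuous_map M.mtopology euclidean (\<lambda>x. x)"
  obtains C where "C > 0" "\<And>x. x \<in> V \<Longrightarrow> norm x \<le> C * hnorm x"
proof -
  have "openin M.mtopology {x \<in> V. x \<in> ball 0 1}"
    using openin_continuous_map_preimage[OF assms, of "ball 0 1"] by simp
  moreover have "0 \<in> {x \<in> V. x \<in> ball 0 1}" by simp
  ultimately obtain r where r: "r > 0" "M.mball 0 r \<subseteq> {x \<in> V. x \<in> ball 0 1}"
    unfolding M.openin_mtopology by meson
  have "norm x \<le> (2 / r) * hnorm x" if x: "x \<in> V" for x
  proof (cases "x = 0")
    case False
    then have p: "hnorm x > 0" using x by (metis hnorm_eq_0_iff hnorm_nonneg less_eq_real_def)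
    \<comment> \<open>Scaled to norm \<open>r / 2\<close>, the vector lies inside the open ball of
      radius \<open>r\<close>; hence the constant \<open>2 / r\<close>.\<close>
    define c where "c = r / (2 * hnorm x)"
    have c: "c > 0" using p r by (simp add: c_def)
    have "ip_dist V h 0 (c *\<^sub>R x) = c * hnorm x"
      using x c by (simp add: ip_dist_eq hnorm_minus hnorm_scaleR)
    also have "\<dots> < r" using p r by (simp add: c_def)
    finally have "c *\<^sub>R x \<in> M.mball 0 r" using x by simp
    then have "c * norm x < 1" using r c by auto
    then show ?thesis using c p r by (simp add: c_def field_simps)
  qed simp
  with that[of "2 / r"] r show ?thesis by simp
qed

lemma continuous_embedding_if_bound:
  assumes "\<And>x. x \<in> V \<Longrightarrow> norm x \<le> C * hnorm x"
  shows "continuous_map M.mtopology euclidean (\<lambda>x. x)"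
  unfolding M.continuous_map_from_metric
proof (intro conjI ballI allI impI)
  fix a U assume a: "a \<in> V" and U: "openin euclidean U \<and> a \<in> U"
  then obtain e where e: "e > 0" "ball a e \<subseteq> U" by (meson open_contains_ball open_openin)
  have C1: "0 < \<bar>C\<bar> + 1" by simp
  have "dist a x < e" if "x \<in> V \<and> ip_dist V h a x < e / (\<bar>C\<bar> + 1)" for x
  proof -
    have "dist a x \<le> C * hnorm (a - x)"
      unfolding dist_norm using that a by (intro assms) simp
    also have "\<dots> \<le> (\<bar>C\<bar> + 1) * hnorm (a - x)"
      using that a by (intro mult_right_mono) auto
    also have "\<dots> < e" using that a C1 by (simp add: field_simps flip: ip_dist_eq)
    finally show ?thesis .
  qed
  then show "\<exists>r>0. \<forall>x. x \<in> V \<and> ip_dist V h a x < r \<longrightarrow> x \<in> U"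
    using e C1 by (meson divide_pos_pos mem_ball subsetD)
qed simp

end


section \<open>Hilbert and Krein spaces inside the ambient space\<close>

lemma (in pre_hilbert_form) mcomplete_iff:
  "M.mcomplete \<longleftrightarrow> (\<forall>s. (\<forall>n. s n \<in> V) \<longrightarrow>
     (\<forall>e>0. \<exists>N. \<forall>m\<ge>N. \<forall>n\<ge>N. hnorm (s m - s n) < e) \<longrightarrow>
     (\<exists>l\<in>V. (\<lambda>n. hnorm (s n - l)) \<longlonglongrightarrow> 0))"
proof -
  have C: "M.MCauchy s \<longleftrightarrow> (\<forall>e>0. \<exists>N. \<forall>m\<ge>N. \<forall>n\<ge>N. hnorm (s m - s n) < e)"
    if "\<And>n. s n \<in> V" for s :: "nat \<Rightarrow> 'a"
    using that by (auto simp: M.MCauchy_def ip_dist_eq)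
  show ?thesis
    unfolding M.mcomplete_def
  proof (intro iffI allI impI)
    fix s :: "nat \<Rightarrow> 'a" assume L: "\<forall>\<sigma>. M.MCauchy \<sigma> \<longrightarrow> (\<exists>x. limitin M.mtopology \<sigma> x sequentially)"
      and s: "\<forall>n. s n \<in> V" "\<forall>e>0. \<exists>N. \<forall>m\<ge>N. \<forall>n\<ge>N. hnorm (s m - s n) < e"
    then obtain x where "limitin M.mtopology s x sequentially" using C[of s] by blast
    then show "\<exists>l\<in>V. (\<lambda>n. hnorm (s n - l)) \<longlonglongrightarrow> 0" using s limitin_iff[of s x] by blast
  next
    fix s :: "nat \<Rightarrow> 'a" assume R: "\<forall>s. (\<forall>n. s n \<in> V) \<longrightarrow> (\<forall>e>0. \<exists>N. \<forall>m\<ge>N. \<forall>n\<ge>N. hnorm (s m - s n) < e) \<longrightarrow>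
       (\<exists>l\<in>V. (\<lambda>n. hnorm (s n - l)) \<longlonglongrightarrow> 0)" and s: "M.MCauchy s"
    then have sV: "\<And>n. s n \<in> V" by (auto simp: M.MCauchy_def)
    with R s C[of s] obtain l where "l \<in> V" "(\<lambda>n. hnorm (s n - l)) \<longlonglongrightarrow> 0" by blast
    then show "\<exists>x. limitin M.mtopology s x sequentially" using limitin_iff[of s l] sV by blast
  qed
qed

locale hilbert_form = pre_hilbert_form +
  assumes mcomplete: "Metric_space.mcomplete V (ip_dist V h)"
begin

lemma complete:
  assumes "\<And>n. s n \<in> V" and "\<And>e. e > 0 \<Longrightarrow> \<exists>N. \<forall>m\<ge>N. \<forall>n\<ge>N. hnorm (s m - s n) < e"
  obtains l where "l \<in> V" "(\<lambda>n. hnorm (s n - l)) \<longlonglongrightarrow> 0"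
  using mcomplete assms unfolding mcomplete_iff by blast

text \<open>Nearest-point projection: a minimizing sequence for the distance of x to D is Cauchy by the
  parallelogram law.\<close>

lemma dense_if_orthogonal_trivial:
  assumes D: "csubspace D" "D \<subseteq> V"
    and orth: "\<And>z. z \<in> V \<Longrightarrow> (\<And>u. u \<in> D \<Longrightarrow> h z u = 0) \<Longrightarrow> z = 0"
  shows "M.mtopology closure_of D = V"
proof
  show "M.mtopology closure_of D \<subseteq> V"
    using closure_of_subset_topspace[of M.mtopology D] by simp
  show "V \<subseteq> M.mtopology closure_of D"
  proof
    fix x assume x: "x \<in> V"
    have DV: "u \<in> D \<Longrightarrow> u \<in> V" for u using D(2) by auto
    define d where "d = (INF y\<in>D. (hnorm (x - y))\<^sup>2)"
    have D0: "D \<noteq> {}" using complex_vector.subspace_0[OF D(1)] by auto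
    have bdd: "bdd_below ((\<lambda>y. (hnorm (x - y))\<^sup>2) ` D)"
      by (intro bdd_belowI2[of _ 0]) simp
    have dle: "d \<le> (hnorm (x - y))\<^sup>2" if "y \<in> D" for y
      unfolding d_def by (rule cINF_lower[OF bdd that])
    have "\<exists>y\<in>D. (hnorm (x - y))\<^sup>2 < d + 1 / real (Suc n)" for n
    proof -
      have "(INF y\<in>D. (hnorm (x - y))\<^sup>2) < d + 1 / real (Suc n)" by (simp add: d_def)
      then show ?thesis by (subst (asm) cINF_less_iff[OF D0 bdd])
    qed
    then obtain y where y: "\<And>n. y n \<in> D" "\<And>n. (hnorm (x - y n))\<^sup>2 < d + 1 / real (Suc n)"
      by metis
    have yV: "y n \<in> V" for n using y(1) DV by simp
    have gap: "(hnorm (y m - y n))\<^sup>2 \<le> 2 / real (Suc m) + 2 / real (Suc n)" for m n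
    proof -
      \<comment> \<open>The midpoint lies in \<open>D\<close>, so its squared distance to
        \<open>x\<close> is at least \<open>d\<close>. In the parallelogram law this leaves only the
        two excesses over \<open>d\<close> for the difference of \<open>y m\<close> and
        \<open>y n\<close>.\<close>
      have mid: "(1/2) *\<^sub>R (y m + y n) \<in> D"
        using complex_vector.subspace_scale[OF D(1), of "y m + y n" "of_real (1/2)"]
          complex_vector.subspace_add[OF D(1) y(1) y(1)] by (simp only: scaleC_of_real)
      have "(x - y m) + (x - y n) = 2 *\<^sub>R (x - (1/2) *\<^sub>R (y m + y n))"
        by (simp add: algebra_simps scaleR_2)
      then have "(hnorm ((x - y m) + (x - y n)))\<^sup>2 = 4 * (hnorm (x - (1/2) *\<^sub>R (y m + y n)))\<^sup>2"
        using x yV by (simp only: hnorm_scaleR[OF diff_in[OF x DV[OF mid]]]) (simp add: power_mult_distrib)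
      then have "4 * d \<le> (hnorm ((x - y m) + (x - y n)))\<^sup>2" using dle[OF mid] by simp
      moreover have "hnorm ((x - y m) - (x - y n)) = hnorm (y m - y n)"
        using yV by (simp add: hnorm_diff_commute)
      ultimately show ?thesis
        using parallelogram[of "x - y m" "x - y n"] y(2)[of m] y(2)[of n] x yV by simp
    qed
    have "\<exists>N. \<forall>m\<ge>N. \<forall>n\<ge>N. hnorm (y m - y n) < e" if e: "e > 0" for e :: real
    proof -
      obtain N :: nat where N: "4 / e\<^sup>2 < real (Suc N)" using reals_Archimedean2 
        by (metis less_trans of_nat_less_iff lessI)
      have "hnorm (y m - y n) < e" if "m \<ge> N" "n \<ge> N" for m n
      proof (rule power2_less_imp_less)
        have "2 / real (Suc m) + 2 / real (Suc n) \<le> 2 / real (Suc N) + 2 / real (Suc N)"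
          using that by (intro add_mono divide_left_mono) auto
        also have "\<dots> = 4 / real (Suc N)" by simp
        also have "\<dots> < e\<^sup>2" using N e by (simp add: field_simps del: of_nat_Suc)
        finally show "(hnorm (y m - y n))\<^sup>2 < e\<^sup>2" using gap[of m n] by simp
      qed (use e in simp)
      then show ?thesis by blast
    qed
    then obtain l where l: "l \<in> V" "(\<lambda>n. hnorm (y n - l)) \<longlonglongrightarrow> 0"
      using complete[of y] yV by blast
    define z where "z = x - l"
    have zV: "z \<in> V" using x l by (simp add: z_def)
    have z_le: "hnorm z \<le> sqrt d"
    proof (rule LIMSEQ_le_const)
      have "(\<lambda>n. sqrt (d + 1 / real (Suc n)) + hnorm (y n - l)) \<longlonglongrightarrow> sqrt (d + 0) + 0"
        using LIMSEQ_inverse_real_of_nat l(2) unfolding inverse_eq_divide by (intro tendsto_intros)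
      then show "(\<lambda>n. sqrt (d + 1 / real (Suc n)) + hnorm (y n - l)) \<longlonglongrightarrow> sqrt d" by simp
      have "hnorm z \<le> sqrt (d + 1 / real (Suc n)) + hnorm (y n - l)" for n
      proof -
        have "hnorm z \<le> hnorm (x - y n) + hnorm (y n - l)"
          using hnorm_triangle[of "x - y n" "y n - l"] x yV l by (simp add: z_def)
        moreover have "hnorm (x - y n) \<le> sqrt (d + 1 / real (Suc n))"
          using y(2)[of n] by (intro real_le_rsqrt) simp
        ultimately show ?thesis by simp
      qed
      then show "\<exists>N. \<forall>n\<ge>N. hnorm z \<le> sqrt (d + 1 / real (Suc n)) + hnorm (y n - l)" by blast
    qed
    have z_ge: "sqrt d \<le> hnorm (z - u)" if u: "u \<in> D" for u
    proof (rule LIMSEQ_le_const)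
      show "(\<lambda>n. hnorm (z - u) + hnorm (y n - l)) \<longlonglongrightarrow> hnorm (z - u)"
        using tendsto_add[OF tendsto_const l(2)] by simp
      have "sqrt d \<le> hnorm (z - u) + hnorm (y n - l)" for n
      proof -
        have "y n + u \<in> D" by (rule complex_vector.subspace_add[OF D(1) y(1) u])
        then have "sqrt d \<le> hnorm (x - (y n + u))"
          using dle[of "y n + u"] x by (intro real_le_lsqrt) (simp_all add: DV)
        also have "x - (y n + u) = (z - u) + (l - y n)" by (simp add: z_def)
        also have "hnorm \<dots> \<le> hnorm (z - u) + hnorm (l - y n)"
          using zV u DV l yV by (intro hnorm_triangle) auto
        finally show ?thesis using l yV by (simp add: hnorm_diff_commute)
      qed
      then show "\<exists>N. \<forall>n\<ge>N. sqrt d \<le> hnorm (z - u) + hnorm (y n - l)" by blast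
    qed
    have "h z u = 0" if u: "u \<in> D" for u
    proof (rule ccontr)
      assume nz: "h z u \<noteq> 0"
      \<comment> \<open>With this \<open>t\<close> the factor \<open>t * Re (h u u) - 2\<close> is
        negative even when \<open>Re (h u u)\<close> vanishes, so moving from \<open>z\<close> along
        \<open>u\<close> would strictly shorten \<open>z\<close>, against its minimality.\<close>
      define t where "t = 1 / (Re (h u u) + 1)"
      have huu: "0 \<le> Re (h u u)" using nonneg DV u by simp
      have "(of_real t * h z u) *\<^sub>C u \<in> D" by (rule complex_vector.subspace_scale[OF D(1) u])
      then have "hnorm z \<le> hnorm (z - (of_real t * h z u) *\<^sub>C u)" using z_ge z_le by (meson order_trans)
      then have "(hnorm z)\<^sup>2 \<le> (hnorm (z - (of_real t * h z u) *\<^sub>C u))\<^sup>2"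
        using zV by (intro power_mono) auto
      then have "0 \<le> (cmod (h z u))\<^sup>2 * (t * (t * Re (h u u) - 2))"
        using zV DV[OF u] Re_diagonal_diff[OF zV DV[OF u], of t] by (simp add: hnorm_power2) (simp add: algebra_simps power2_eq_square)
      moreover have "t * Re (h u u) - 2 < 0" "t > 0" using huu by (auto simp: t_def field_simps)
      then have "t * (t * Re (h u u) - 2) < 0" by (simp add: mult_pos_neg)
      then have "(cmod (h z u))\<^sup>2 * (t * (t * Re (h u u) - 2)) < 0" using nz by (simp add: mult_pos_neg)
      ultimately show False by simp
    qed
    then have "z = 0" by (rule orth[OF zV])
    then have "x = l" by (simp add: z_def)
    then have lim: "(\<lambda>n. hnorm (y n - x)) \<longlonglongrightarrow> 0" using l by simp
    have "\<exists>u\<in>D. ip_dist V h x u < r" if "r > 0" for r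
    proof -
      from order_tendstoD(2)[OF lim that] obtain n where "hnorm (y n - x) < r"
        by (auto simp: eventually_sequentially)
      then show ?thesis using x yV y(1) by (metis hnorm_diff_commute ip_dist_eq)
    qed
    then show "x \<in> M.mtopology closure_of D"
      using x DV by (auto simp: M.metric_closure_of)
  qed
qed

end

lemma hilbert_on_imp_hilbert_form: "hilbert_on V h \<Longrightarrow> hilbert_form V h"
  unfolding hilbert_on_def by unfold_locales auto

lemma hilbert_form_imp_hilbert_on: "hilbert_form V h \<Longrightarrow> hilbert_on V h"
proof -
  assume "hilbert_form V h"
  then interpret hilbert_form V h .
  show ?thesis unfolding hilbert_on_def using subspace_V hermitian pos mcomplete by auto
qed

text \<open>\<open>krein_topology\<close> selects a symmetry by \<open>SOME\<close>, which says
  nothing unless one exists. As the sum is direct, \<open>x + y\<close> determines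
  \<open>x - y\<close>.\<close>

lemma fundamental_symmetry_exists:
  assumes "fundamental_decomposition K ip Kp Km"
  shows "\<exists>J. fundamental_symmetry K ip J"
proof -
  interpret P: hilbert_form Kp ip
    using assms by (auto simp: fundamental_decomposition_def intro: hilbert_on_imp_hilbert_form)
  interpret N: hilbert_form Km "\<lambda>x y. - ip x y"
    using assms by (auto simp: fundamental_decomposition_def intro: hilbert_on_imp_hilbert_form)
  have int: "Kp \<inter> Km = {0}" using assms by (simp add: fundamental_decomposition_def)
  define J where "J z = (THE w. \<exists>x\<in>Kp. \<exists>y\<in>Km. z = x + y \<and> w = x - y)" for z
  have "J (x + y) = x - y" if "x \<in> Kp" "y \<in> Km" for x y
    unfolding J_def
  proof (rule the_equality)
    fix w assume "\<exists>x'\<in>Kp. \<exists>y'\<in>Km. x + y = x' + y' \<and> w = x' - y'"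
    then obtain x' y' where *: "x' \<in> Kp" "y' \<in> Km" "x + y = x' + y'" "w = x' - y'" by blast
    have "x - x' = y' - y" using * by (simp add: algebra_simps)
    moreover have "x - x' \<in> Kp" "y' - y \<in> Km" using * that by auto
    ultimately have "x - x' = 0" "y' - y = 0" using int by (metis Int_iff singletonD)+
    with * show "w = x - y" by simp
  qed (use that in blast)
  then show ?thesis using assms unfolding fundamental_symmetry_def by blast
qed

section \<open>Krein spaces with a given fundamental symmetry\<close>

locale krein_form = K: hermitian_form K ip + P: hilbert_form Kp ip + N: hilbert_form Km "\<lambda>x y. - ip x y"
  for K Kp Km :: "'a::complex_hilbert set" and ip +
  fixes J :: "'a \<Rightarrow> 'a"
  assumes sum: "K = {x + y |x y. x \<in> Kp \<and> y \<in> Km}" and int: "Kp \<inter> Km = {0}"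
    and orth: "x \<in> Kp \<Longrightarrow> y \<in> Km \<Longrightarrow> ip x y = 0"
    and J: "x \<in> Kp \<Longrightarrow> y \<in> Km \<Longrightarrow> J (x + y) = x - y"
begin

lemma Kp_subset: "x \<in> Kp \<Longrightarrow> x \<in> K"
  using N.zero_in unfolding sum by (metis (mono_tags, lifting) add.right_neutral mem_Collect_eq)

lemma Km_subset: "x \<in> Km \<Longrightarrow> x \<in> K"
  using P.zero_in unfolding sum by (metis (mono_tags, lifting) add.left_neutral mem_Collect_eq)

lemma decompose:
  assumes "z \<in> K" obtains x y where "x \<in> Kp" "y \<in> Km" "z = x + y"
  using assms unfolding sum by blast

lemma orth': "x \<in> Kp \<Longrightarrow> y \<in> Km \<Longrightarrow> ip y x = 0"
  using K.commute[of x y] by (simp add: orth Kp_subset Km_subset)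

lemma J_in [simp]: "z \<in> K \<Longrightarrow> J z \<in> K"
  by (elim decompose) (simp add: J Kp_subset Km_subset)

lemma J_J [simp]: "z \<in> K \<Longrightarrow> J (J z) = z"
proof (elim decompose)
  fix x y assume "x \<in> Kp" "y \<in> Km" "z = x + y"
  then show ?thesis using J[of x "- y"] by (simp add: J)
qed

lemma J_add: "z \<in> K \<Longrightarrow> w \<in> K \<Longrightarrow> J (z + w) = J z + J w"
proof (elim decompose)
  fix x y x' y' assume *: "x \<in> Kp" "y \<in> Km" "z = x + y" "x' \<in> Kp" "y' \<in> Km" "w = x' + y'"
  then have "z + w = (x + x') + (y + y')" by simp
  then have "J (z + w) = (x + x') - (y + y')" using * J[of "x + x'" "y + y'"] by (metis P.add_in N.add_in)
  then show ?thesis using * by (simp add: J)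
qed

lemma J_scaleC: "z \<in> K \<Longrightarrow> J (a *\<^sub>C z) = a *\<^sub>C J z"
proof (elim decompose)
  fix x y assume *: "x \<in> Kp" "y \<in> Km" "z = x + y"
  then show ?thesis using J[of "a *\<^sub>C x" "a *\<^sub>C y"]
    by (simp add: J complex_vector.scale_right_distrib complex_vector.scale_right_diff_distrib)
qed

lemma ip_J_sum: "x \<in> Kp \<Longrightarrow> y \<in> Km \<Longrightarrow> x' \<in> Kp \<Longrightarrow> y' \<in> Km \<Longrightarrow>
    ip (J (x + y)) (x' + y') = ip x x' - ip y y'"
  by (simp add: J K.expand Kp_subset Km_subset orth orth')

lemma J_symmetric: "z \<in> K \<Longrightarrow> w \<in> K \<Longrightarrow> ip (J z) w = ip z (J w)"
proof (elim decompose)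
  fix x y x' y' assume *: "x \<in> Kp" "y \<in> Km" "z = x + y" "x' \<in> Kp" "y' \<in> Km" "w = x' + y'"
  then show ?thesis by (simp add: ip_J_sum) (simp add: J K.expand Kp_subset Km_subset orth orth')
qed

sublocale H: pre_hilbert_form K "\<lambda>x y. ip (J x) y"
proof
  show "csubspace K" by (rule K.subspace_V)
  show "hermitian_on K (\<lambda>x y. ip (J x) y)"
    unfolding hermitian_on_def
  proof (intro conjI ballI allI)
    fix x y assume *: "x \<in> K" "y \<in> K"
    show "ip (J y) x = cnj (ip (J x) y)" using * J_symmetric[of y x] K.commute[of "J x" y] by simp
  qed (simp_all add: J_add J_scaleC K.expand)
  show "0 < Re (ip (J z) z)" if z: "z \<in> K" "z \<noteq> 0" for z
    using z(1)
  proof (rule decompose)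
    fix x y assume *: "x \<in> Kp" "y \<in> Km" "z = x + y"
    then have "x \<noteq> 0 \<or> y \<noteq> 0" using z by auto
    then show ?thesis using * P.pos[of x] N.pos[of y] P.nonneg[of x] N.nonneg[of y]
      by (auto simp: ip_J_sum)
  qed
qed

lemma hnorm_sum:
  assumes "x \<in> Kp" "y \<in> Km" shows "(H.hnorm (x + y))\<^sup>2 = (P.hnorm x)\<^sup>2 + (N.hnorm y)\<^sup>2"
proof -
  have "x + y \<in> K" using assms by (simp add: Kp_subset Km_subset)
  then show ?thesis using assms by (simp add: H.hnorm_power2 P.hnorm_power2 N.hnorm_power2 ip_J_sum)
qed

text \<open>By Pythagoras the components of a Cauchy sequence are Cauchy in \<open>Kp\<close> and
  \<open>Km\<close>, and their limits add up to a limit of the sequence.\<close>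

sublocale H: hilbert_form K "\<lambda>x y. ip (J x) y"
proof
  show "H.M.mcomplete"
    unfolding H.mcomplete_iff
  proof (intro allI impI)
    fix s :: "nat \<Rightarrow> 'a" assume s: "\<forall>n. s n \<in> K" and C: "\<forall>e>0. \<exists>N. \<forall>m\<ge>N. \<forall>n\<ge>N. H.hnorm (s m - s n) < e"
    have "\<exists>x y. x \<in> Kp \<and> y \<in> Km \<and> s n = x + y" for n using s decompose by blast
    then obtain x y where xy: "\<And>n. x n \<in> Kp" "\<And>n. y n \<in> Km" "\<And>n. s n = x n + y n" by metis
    have d: "(H.hnorm (s m - s n))\<^sup>2 = (P.hnorm (x m - x n))\<^sup>2 + (N.hnorm (y m - y n))\<^sup>2" for m n
    proof -
      have "s m - s n = (x m - x n) + (y m - y n)" by (simp add: xy(3))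
      then show ?thesis using hnorm_sum[of "x m - x n" "y m - y n"] xy(1,2) P.diff_in N.diff_in by metis
    qed
    have "P.hnorm (x m - x n) \<le> H.hnorm (s m - s n)" "N.hnorm (y m - y n) \<le> H.hnorm (s m - s n)" for m n
      by (rule power2_le_imp_le; use d[of m n] s in simp)+
    then have "\<And>e. e > 0 \<Longrightarrow> \<exists>N. \<forall>m\<ge>N. \<forall>n\<ge>N. P.hnorm (x m - x n) < e"
      "\<And>e. e > 0 \<Longrightarrow> \<exists>N. \<forall>m\<ge>N. \<forall>n\<ge>N. N.hnorm (y m - y n) < e"
      using C by (meson le_less_trans)+
    then obtain a b where a: "a \<in> Kp" "(\<lambda>n. P.hnorm (x n - a)) \<longlonglongrightarrow> 0"
      and b: "b \<in> Km" "(\<lambda>n. N.hnorm (y n - b)) \<longlonglongrightarrow> 0"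
      using P.complete[of x] N.complete[of y] xy(1,2) by metis
    have "(H.hnorm (s n - (a + b)))\<^sup>2 = (P.hnorm (x n - a))\<^sup>2 + (N.hnorm (y n - b))\<^sup>2" for n
    proof -
      have "s n - (a + b) = (x n - a) + (y n - b)" by (simp add: xy(3))
      then show ?thesis using hnorm_sum[of "x n - a" "y n - b"] xy(1,2) a(1) b(1) P.diff_in N.diff_in by metis
    qed
    moreover have "a + b \<in> K" using a b by (simp add: Kp_subset Km_subset)
    ultimately have "H.hnorm (s n - (a + b)) = sqrt ((P.hnorm (x n - a))\<^sup>2 + (N.hnorm (y n - b))\<^sup>2)" for n
      using s by (metis H.diff_in H.hnorm_nonneg real_sqrt_unique)
    moreover have "(\<lambda>n. sqrt ((P.hnorm (x n - a))\<^sup>2 + (N.hnorm (y n - b))\<^sup>2)) \<longlonglongrightarrow> sqrt (0\<^sup>2 + 0\<^sup>2)"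
      by (intro tendsto_intros a b)
    ultimately have "(\<lambda>n. H.hnorm (s n - (a + b))) \<longlonglongrightarrow> 0" by simp
    then show "\<exists>l\<in>K. (\<lambda>n. H.hnorm (s n - l)) \<longlonglongrightarrow> 0" using \<open>a + b \<in> K\<close> by blast
  qed
qed

lemma hnorm_J: "z \<in> K \<Longrightarrow> H.hnorm (J z) = H.hnorm z"
  by (simp add: H.hnorm_def J_symmetric)

lemma Cauchy_Schwarz_ip: "z \<in> K \<Longrightarrow> w \<in> K \<Longrightarrow> cmod (ip z w) \<le> H.hnorm z * H.hnorm w"
  using H.Cauchy_Schwarz[of "J z" w] by (simp add: hnorm_J)

end

text \<open>Turns the selected symmetry into a parameter of \<open>krein_form\<close>. Only the
  locale assumptions are known of it, so later arguments hold for whichever symmetry was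
  selected.\<close>

lemma krein_space_obtains:
  assumes "krein_space K ip"
  obtains Kp Km J where "krein_form K Kp Km ip J"
    "krein_topology K ip = Metric_space.mtopology K (ip_dist K (\<lambda>x y. ip (J x) y))"
proof -
  define J where "J = (SOME J. fundamental_symmetry K ip J)"
  have "fundamental_symmetry K ip J"
  proof -
    have "\<exists>J. fundamental_symmetry K ip J"
      using assms fundamental_symmetry_exists unfolding krein_space_def by blast
    then show ?thesis unfolding J_def by (rule someI_ex)
  qed
  then obtain Kp Km where F: "fundamental_decomposition K ip Kp Km" "\<And>x y. x \<in> Kp \<Longrightarrow> y \<in> Km \<Longrightarrow> J (x + y) = x - y"
    unfolding fundamental_symmetry_def by blast
  have "krein_form K Kp Km ip J"
    using F assms hilbert_on_imp_hilbert_form unfolding fundamental_decomposition_def krein_space_def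
    by (intro krein_form.intro krein_form_axioms.intro hermitian_form.intro) auto
  moreover have "krein_topology K ip = Metric_space.mtopology K (ip_dist K (\<lambda>x y. ip (J x) y))"
    by (simp add: krein_topology_def J_def Let_def)
  ultimately show ?thesis by (rule that)
qed


section \<open>Completions represented by the inverse of T\<close>

lemma cinner_pre_hilbert_form: "pre_hilbert_form UNIV (cinner :: 'a::complex_hilbert \<Rightarrow> _)"
proof
  show "csubspace (UNIV :: 'a set)" by (rule complex_vector.subspace_UNIV)
  show "hermitian_on UNIV (cinner :: 'a \<Rightarrow> _)"
    unfolding hermitian_on_def using cinner_add_left cinner_scaleC_left cinner_commute by blast
  show "0 < Re (cinner x x)" if "x \<noteq> 0" for x :: 'a
    using that by (simp flip: norm_power2_eq_cinner)
qed

interpretation cinner: pre_hilbert_form UNIV cinner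
  by (rule cinner_pre_hilbert_form)

lemma hnorm_cinner [simp]: "cinner.hnorm = norm"
  by (rule ext) (simp add: cinner.hnorm_def flip: norm_power2_eq_cinner)


lemma cinner_expand:
  "cinner (x + y) z = cinner x z + cinner y z" "cinner z (x + y) = cinner z x + cinner z y"
  "cinner (x - y) z = cinner x z - cinner y z" "cinner z (x - y) = cinner z x - cinner z y"
  "cinner (- x) z = - cinner x z" "cinner z (- x) = - cinner z x"
  "cinner (a *\<^sub>C x) z = a * cinner x z" "cinner z (a *\<^sub>C x) = cnj a * cinner z x"
  "cinner (r *\<^sub>R x) z = of_real r * cinner x z" "cinner z (r *\<^sub>R x) = of_real r * cinner z x"
  by (simp_all add: cinner.expand)

lemma cinner_zero [simp]: "cinner 0 x = 0" "cinner x 0 = 0"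
  by simp_all

lemma cmod_cinner_le: "cmod (cinner x y) \<le> norm x * norm y"
  using cinner.Cauchy_Schwarz[of x y] by simp

lemma norm_scaleC [simp]: "norm (a *\<^sub>C x) = cmod a * norm x"
  using cinner.hnorm_scaleC[of x a] by simp

lemma cinner_self: "cinner x x = of_real ((norm x)\<^sup>2)"
  using cinner_commute[of x x] by (simp add: norm_power2_eq_cinner complex_eq_iff)

lemma cinner_self_eq_0 [simp]: "cinner x x = 0 \<longleftrightarrow> x = 0"
  by (simp add: cinner_self)

lemma bounded_bilinear_cinner: "bounded_bilinear cinner"
proof
  show "\<exists>K. \<forall>a b. norm (cinner a b) \<le> norm a * norm b * K"
    by (rule exI[of _ 1]) (simp add: cmod_cinner_le)
qed (simp_all add: cinner_expand scaleR_conv_of_real)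

lemma bounded_linear_scaleC: "bounded_linear (\<lambda>x. a *\<^sub>C x)"
proof
  show "a *\<^sub>C (r *\<^sub>R x) = r *\<^sub>R a *\<^sub>C x" for r x
    by (simp add: scaleC_scaleC mult.commute flip: scaleC_of_real)
  show "\<exists>K. \<forall>x. norm (a *\<^sub>C x) \<le> norm x * K"
    by (rule exI[of _ "cmod a"]) (simp add: mult.commute)
qed (rule scaleC_add_right)

lemma orthogonal_to_dense:
  assumes "closure D = UNIV" and "\<And>x. x \<in> D \<Longrightarrow> cinner x z = 0"
  shows "z = 0"
proof -
  have "continuous_on UNIV (\<lambda>x. cinner x z)"
    by (intro linear_continuous_on bounded_bilinear.bounded_linear_left[OF bounded_bilinear_cinner])
  then have "cinner z z = 0"
    using assms continuous_constant_on_closure[of D "\<lambda>x. cinner x z" 0 z] by simp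
  then show ?thesis by simp
qed

text \<open>Baire's theorem: the closed sets \<open>F n\<close> cover the complete space, so one of
  them contains a ball about \<open>u\<close> of radius \<open>r\<close>. A multiple
  \<open>v\<close> of \<open>y\<close> of norm \<open>r\<close> is the difference of
  \<open>u + v\<close> and \<open>u\<close>, both in that ball, and \<open>cinner y v\<close> has
  modulus \<open>r * norm y\<close>.\<close>

lemma weakly_bounded_imp_bounded:
  fixes B :: "'a::complex_hilbert set"
  assumes "\<And>u. \<exists>C. \<forall>y\<in>B. cmod (cinner y u) \<le> C"
  obtains C where "\<And>y. y \<in> B \<Longrightarrow> norm y \<le> C"
proof -
  define F where "F n = {u. \<forall>y\<in>B. cmod (cinner y u) \<le> real n}" for n :: nat
  have cl: "closed (F n)" for n
    unfolding F_def Collect_ball_eq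
    by (intro closed_INT ballI closed_Collect_le continuous_intros
        bounded_bilinear.continuous_on[OF bounded_bilinear_cinner])
  have un: "\<Union> (range F) = UNIV"
  proof -
    have "\<exists>n. u \<in> F n" for u
    proof -
      obtain C where "\<forall>y\<in>B. cmod (cinner y u) \<le> C" using assms by blast
      moreover obtain n :: nat where "C \<le> real n" using real_arch_simple by blast
      ultimately show ?thesis unfolding F_def by (blast intro: order_trans)
    qed
    then show ?thesis by blast
  qed
  have "\<exists>n. interior (F n) \<noteq> {}"
  proof (rule ccontr)
    assume "\<not> ?thesis"
    then have "Met_TC.mtopology interior_of \<Union> (range F) = ({} :: 'a set)"
      using cl by (intro Met_TC.metric_Baire_category_alt) (auto simp: complete_UNIV)
    then show False unfolding un by simp
  qed
  then obtain n u r where r: "r > 0" and sub: "cball u r \<subseteq> F n"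
    by (metis all_not_in_conv mem_interior_cball)
  have "norm y \<le> 2 * real n / r" if y: "y \<in> B" for y
  proof (cases "y = 0")
    case True then show ?thesis using r by simp
  next
    case False
    define v where "v = (r / norm y) *\<^sub>R y"
    have "norm v = r" using False r by (simp add: v_def)
    then have "u + v \<in> F n" "u \<in> F n" using sub r by (auto simp: dist_norm)
    then have "cmod (cinner y (u + v)) \<le> n" "cmod (cinner y u) \<le> n" using y by (auto simp: F_def)
    then have "cmod (cinner y v) \<le> 2 * real n"
      using norm_triangle_ineq4[of "cinner y (u + v)" "cinner y u"] by (simp add: cinner_expand)
    moreover have "cmod (cinner y v) = r * norm y"
      using False r by (simp add: v_def cinner_expand cinner_self norm_mult power2_eq_square norm_divide)
    ultimately show ?thesis using r by (simp add: field_simps)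
  qed
  then show ?thesis by (rule that)
qed

section \<open>The operator and its inverse\<close>

locale invertible_self_adjoint =
  fixes T :: "'a::complex_hilbert \<rightharpoonup> 'a"
  assumes sa: "self_adjoint T" and bi: "boundedly_invertible T"
begin

definition S :: "'a \<Rightarrow> 'a" where "S = inv_into (dom T) (\<lambda>x. the (T x))"

lemma S_in [simp]: "S u \<in> dom T"
  using bi unfolding boundedly_invertible_def S_def bij_betw_def by (metis UNIV_I inv_into_into)

lemma T_S [simp]: "the (T (S u)) = u"
  using bi unfolding boundedly_invertible_def S_def by (metis (no_types, lifting) UNIV_I bij_betw_def f_inv_into_f)

lemma S_T [simp]: "x \<in> dom T \<Longrightarrow> S (the (T x)) = x"
  using bi unfolding boundedly_invertible_def S_def bij_betw_def by (metis (no_types, lifting) inv_into_f_f)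

lemma range_S: "range S = dom T"
  using S_T by (metis S_in image_subset_iff rangeI subsetI subset_antisym)

lemma bounded_linear_S: "bounded_linear S"
  using bi by (simp add: boundedly_invertible_def S_def)

lemma inj_S: "S u = S v \<Longrightarrow> u = v"
  by (metis T_S)

lemma subspace_dom: "csubspace (dom T)"
  using sa by (simp add: self_adjoint_def linear_operator_def)

lemma dense_dom: "closure (dom T) = UNIV"
  using sa by (simp add: self_adjoint_def)

text \<open>Density of the domain makes the vector described in \<open>adjoint_operator\<close>
  unique, so equality of \<open>T\<close> with its adjoint, read at \<open>y\<close>, identifies
  that vector as \<open>the (T y)\<close>.\<close>

lemma T_symmetric:
  assumes x: "x \<in> dom T" and y: "y \<in> dom T"
  shows "cinner (the (T x)) y = cinner x (the (T y))"
proof -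
  let ?P = "\<lambda>z. \<forall>x\<in>dom T. cinner (the (T x)) y = cinner x z"
  have adj: "adjoint_operator T y = T y" using sa by (simp add: self_adjoint_def)
  then have ex: "\<exists>z. ?P z" using y unfolding adjoint_operator_def by (metis domIff)
  have uniq: "z = z'" if "?P z" "?P z'" for z z'
  proof -
    have "z - z' = 0" using that by (intro orthogonal_to_dense[OF dense_dom]) (auto simp: cinner_expand)
    then show ?thesis by simp
  qed
  have "?P (THE z. ?P z)" by (rule theI') (use ex uniq in blast)
  moreover have "T y = Some (THE z. ?P z)" using adj ex unfolding adjoint_operator_def by simp
  ultimately show ?thesis using x by simp
qed

lemma S_symmetric: "cinner (S u) v = cinner u (S v)"
  using T_symmetric[of "S u" "S v"] by simp

lemma operator_form_simps:
  "fst (operator_form T) = dom T"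
  "x \<in> dom T \<Longrightarrow> y \<in> dom T \<Longrightarrow> snd (operator_form T) x y = cinner (the (T x)) y"
  by (simp_all add: operator_form_def)

text \<open>Any fundamental symmetry may define the topology of K, so the bound of the embedding comes
  from uniform boundedness of the functionals given by the unit ball of K.\<close>

lemma representing_krein_space:
  assumes K: "krein_space K ip" and sub: "dom T \<subseteq> K"
    and rep: "\<And>u y. y \<in> K \<Longrightarrow> ip (S u) y = cinner u y"
  shows "continuously_embedded K ip" "krein_topology K ip closure_of dom T = K"
proof -
  obtain Kp Km J where "krein_form K Kp Km ip J"
    and top: "krein_topology K ip = Metric_space.mtopology K (ip_dist K (\<lambda>x y. ip (J x) y))"
    by (rule krein_space_obtains[OF K])
  then interpret krein_form K Kp Km ip J by simp
  have SK: "S u \<in> K" for u using sub S_in by blast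
  have ex: "\<exists>C. \<forall>y\<in>{y \<in> K. H.hnorm y \<le> 1}. cmod (cinner y u) \<le> C" for u
  proof (intro exI ballI)
    fix y assume y: "y \<in> {y \<in> K. H.hnorm y \<le> 1}"
    have "cmod (cinner y u) = cmod (cinner u y)" by (metis cinner_commute complex_mod_cnj)
    also have "\<dots> = cmod (ip (S u) y)" using y rep by simp
    also have "\<dots> \<le> H.hnorm (S u) * H.hnorm y" using y SK by (intro Cauchy_Schwarz_ip) auto
    also have "\<dots> \<le> H.hnorm (S u) * 1" using y SK by (intro mult_left_mono) auto
    finally show "cmod (cinner y u) \<le> H.hnorm (S u) * 1" .
  qed
  then obtain C where C: "\<And>y. y \<in> {y \<in> K. H.hnorm y \<le> 1} \<Longrightarrow> norm y \<le> C"
    using weakly_bounded_imp_bounded[OF ex] by blast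
  have "norm y \<le> C * H.hnorm y" if y: "y \<in> K" for y
  proof (cases "y = 0")
    case False
    then have p: "H.hnorm y > 0" using y H.hnorm_eq_0_iff[of y] H.hnorm_nonneg[of y] by linarith
    have "norm ((1 / H.hnorm y) *\<^sub>R y) \<le> C" using y p by (intro C) (simp add: H.hnorm_scaleR)
    then show ?thesis using p by (simp add: field_simps)
  qed simp
  then show "continuously_embedded K ip"
    unfolding continuously_embedded_def top by (rule H.continuous_embedding_if_bound)
  show "krein_topology K ip closure_of dom T = K"
    unfolding top
  proof (rule H.dense_if_orthogonal_trivial[OF subspace_dom sub])
    fix z assume z: "z \<in> K" and "\<And>u. u \<in> dom T \<Longrightarrow> ip (J z) u = 0"
    \<comment> \<open>Testing against \<open>S (J z)\<close> turns orthogonality for the Krein norm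
      into \<open>cinner (J z) (J z) = 0\<close>, by the representation property.\<close>
    then have "ip (J z) (S (J z)) = 0" by simp
    then have "ip (S (J z)) (J z) = 0" using K.commute[of "J z" "S (J z)"] z SK by simp
    then have "J z = 0" using rep[of "J z" "J z"] J_in[OF z] by simp
    moreover have "J 0 = 0" using J[of 0 0] by simp
    ultimately show "z = 0" using J_J[OF z] by metis
  qed
qed

text \<open>At the gap point 0 the shifted form is \<open>ip\<close> itself, and its domain is dense
  in the ambient space because it contains \<open>dom T\<close>.\<close>

lemma closure_if_completion:
  assumes "(K, ip, A) \<in> \<N> T" shows "(K, ip) \<in> \<M> T"
proof -
  have *: "krein_space K ip" "dom T \<subseteq> K" "krein_topology K ip closure_of dom T = K"
    "\<And>x y. x \<in> dom T \<Longrightarrow> y \<in> dom T \<Longrightarrow> ip x y = snd (operator_form T) x y"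
    "zero_outside K ip" "continuously_embedded K ip"
    using assms by (auto simp: completions_of_operator_form_def krein_completion_def)
  have "closure K = UNIV" using closure_mono[OF *(2)] dense_dom by auto
  then have "is_form (K, ip)"
    using * by (simp add: is_form_def krein_space_def)
  moreover have "shift_form 0 ip = ip" by (simp add: shift_form_def)
  then have "gap_point (K, ip) 0" using * by (simp add: gap_point_def)
  ultimately show ?thesis
    using * \<open>shift_form 0 ip = ip\<close> unfolding closures_of_operator_form_def form_closure_def closed_form_def
    by (auto simp: operator_form_simps form_extends_def operator_form_def intro!: exI[of _ 0])
qed

lemma representing_in_completions:
  assumes K: "krein_space K ip" and sub: "dom T \<subseteq> K"
    and rep: "\<And>u y. y \<in> K \<Longrightarrow> ip (S u) y = cinner u y" and z: "zero_outside K ip"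
  shows "(K, ip, T |` {x \<in> dom T. the (T x) \<in> K}) \<in> \<N> T"
proof -
  have "ip x y = snd (operator_form T) x y" if "x \<in> dom T" "y \<in> dom T" for x y
    using rep[of y "the (T x)"] that sub by (auto simp: operator_form_simps)
  then show ?thesis
    using assms representing_krein_space[OF K sub rep] subspace_dom
    by (simp add: completions_of_operator_form_def krein_completion_def)
qed

end


section \<open>Krein spaces as ranges of operators\<close>

definition symmetric :: "('a::complex_hilbert \<Rightarrow> 'a) \<Rightarrow> bool" where
  "symmetric A \<longleftrightarrow> (\<forall>x y. cinner (A x) y = cinner x (A y))"

definition clinear :: "('a::complex_hilbert \<Rightarrow> 'a) \<Rightarrow> bool" where
  "clinear A \<longleftrightarrow> (\<forall>x y. A (x + y) = A x + A y) \<and> (\<forall>a x. A (a *\<^sub>C x) = a *\<^sub>C A x)"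

lemma cinner_eqI:
  fixes x y :: "'a::complex_hilbert" assumes "\<And>z. cinner x z = cinner y z" shows "x = y"
proof -
  have "cinner (x - y) (x - y) = 0" unfolding cinner_expand(3) assms by simp
  then show ?thesis by simp
qed

lemma clinear_add: "clinear A \<Longrightarrow> A (x + y) = A x + A y"
  and clinear_scaleC: "clinear A \<Longrightarrow> A (a *\<^sub>C x) = a *\<^sub>C A x"
  by (simp_all add: clinear_def)

lemma clinear_scaleR: "clinear A \<Longrightarrow> A (r *\<^sub>R x) = r *\<^sub>R A x"
  by (metis clinear_scaleC scaleC_of_real)

lemma clinear_zero: "clinear A \<Longrightarrow> A 0 = 0"
  using clinear_scaleR[of A 0 0] by simp

lemma clinear_minus: "clinear A \<Longrightarrow> A (- x) = - A x"
  using clinear_scaleR[of A "-1" x] by simp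

lemma clinear_diff: "clinear A \<Longrightarrow> A (x - y) = A x - A y"
  using clinear_add[of A x "- y"] by (simp add: clinear_minus)

lemma symmetricD: "symmetric A \<Longrightarrow> cinner (A x) y = cinner x (A y)"
  by (simp add: symmetric_def)

text \<open>Symmetry moves \<open>A\<close> to the other argument, where sums and scalars split, and
  the inner product separates vectors. Bounded operators of type \<open>blinfun\<close> are only
  known to be real linear; this supplies complex linearity.\<close>

lemma symmetric_imp_clinear:
  assumes "symmetric A" shows "clinear A"
  unfolding clinear_def
proof (intro conjI allI)
  show "A (x + y) = A x + A y" for x y
    by (rule cinner_eqI) (simp add: symmetricD[OF assms] cinner_expand)
  show "A (a *\<^sub>C x) = a *\<^sub>C A x" for a x
    by (rule cinner_eqI) (simp add: symmetricD[OF assms] cinner_expand)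
qed

lemma symmetric_involution_norm:
  assumes "symmetric J" "\<And>x. J (J x) = x" shows "norm (J x) = norm x"
proof -
  have "cinner (J x) (J x) = cinner x x" by (simp add: symmetricD[OF assms(1)] assms(2))
  then show ?thesis by (simp add: cinner_self flip: of_real_power)
qed

lemma symmetric_involution_bounded_linear:
  assumes "symmetric J" "\<And>x. J (J x) = x" shows "bounded_linear J"
proof
  note lin = symmetric_imp_clinear[OF assms(1)]
  show "J (x + y) = J x + J y" "J (r *\<^sub>R x) = r *\<^sub>R J x" for x y r
    by (simp_all add: clinear_add[OF lin] clinear_scaleR[OF lin])
  show "\<exists>K. \<forall>x. norm (J x) \<le> norm x * K"
    by (rule exI[of _ 1]) (simp add: symmetric_involution_norm[OF assms])
qed

lemma csubspace_image:
  assumes "clinear V" "csubspace E" shows "csubspace (V ` E)"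
  unfolding complex_vector.subspace_def
proof (intro conjI ballI allI)
  show "0 \<in> V ` E"
    using clinear_zero[OF assms(1)] complex_vector.subspace_0[OF assms(2)] by (metis imageI)
  show "x + y \<in> V ` E" if "x \<in> V ` E" "y \<in> V ` E" for x y
    using that complex_vector.subspace_add[OF assms(2)] by (auto simp flip: clinear_add[OF assms(1)])
  show "c *\<^sub>C x \<in> V ` E" if "x \<in> V ` E" for c x
    using that complex_vector.subspace_scale[OF assms(2)] by (auto simp flip: clinear_scaleC[OF assms(1)])
qed

text \<open>On \<open>E\<close> the map \<open>V\<close> is an isometry for \<open>g\<close>, so a
  Cauchy sequence in the image comes from one in \<open>E\<close>, which converges in
  \<open>E\<close> as a closed subset of a complete space.\<close>

lemma hilbert_form_image:
  fixes V :: "'a::complex_hilbert \<Rightarrow> 'a"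
  assumes V: "clinear V" and E: "csubspace E" "closed E"
    and g: "\<And>a b. a \<in> E \<Longrightarrow> b \<in> E \<Longrightarrow> g (V a) (V b) = cinner a b"
  shows "hilbert_form (V ` E) g"
proof -
  note E_simps = complex_vector.subspace_add[OF E(1)] complex_vector.subspace_scale[OF E(1)]
    complex_vector.subspace_diff[OF E(1)]
  interpret pre_hilbert_form "V ` E" g
  proof
    show "csubspace (V ` E)" by (rule csubspace_image[OF V E(1)])
    show "hermitian_on (V ` E) g"
      unfolding hermitian_on_def
    proof (intro conjI ballI allI)
      fix x y z assume "x \<in> V ` E" "y \<in> V ` E" "z \<in> V ` E"
      then show "g (x + y) z = g x z + g y z"
        by (auto simp: g E_simps cinner_expand simp flip: clinear_add[OF V])
    next
      fix a x y assume "x \<in> V ` E" "y \<in> V ` E"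
      then show "g (a *\<^sub>C x) y = a * g x y"
        by (auto simp: g E_simps cinner_expand simp flip: clinear_scaleC[OF V])
    next
      fix x y assume "x \<in> V ` E" "y \<in> V ` E"
      then show "g y x = cnj (g x y)" by (auto simp: g intro: cinner_commute)
    qed
    show "0 < Re (g x x)" if "x \<in> V ` E" "x \<noteq> 0" for x
      using that clinear_zero[OF V] by (auto simp: g cinner_self)
  qed
  have hn: "hnorm (V a) = norm a" if "a \<in> E" for a
    using that by (simp add: hnorm_def g cinner_self)
  show ?thesis
  proof
    show "M.mcomplete"
      unfolding mcomplete_iff
    proof (intro allI impI)
      fix s :: "nat \<Rightarrow> 'a" assume s: "\<forall>n. s n \<in> V ` E"
        and C: "\<forall>e>0. \<exists>N. \<forall>m\<ge>N. \<forall>n\<ge>N. hnorm (s m - s n) < e"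
      then have "\<forall>n. \<exists>a\<in>E. s n = V a" by blast
      then obtain a where a: "\<And>n. a n \<in> E" "\<And>n. s n = V (a n)" by metis
      have "hnorm (s m - s n) = dist (a m) (a n)" for m n
        using hn[of "a m - a n"] a by (simp add: E_simps clinear_diff[OF V] dist_norm)
      then have "Cauchy a" using C by (simp add: Cauchy_def)
      then obtain l where l: "a \<longlonglongrightarrow> l" by (auto simp: Cauchy_convergent_iff convergent_def)
      then have lE: "l \<in> E" using closed_sequentially[OF E(2)] a by blast
      have "hnorm (s n - V l) = norm (a n - l)" for n
        using hn[of "a n - l"] a lE by (simp add: E_simps clinear_diff[OF V])
      then have "(\<lambda>n. hnorm (s n - V l)) \<longlonglongrightarrow> 0" using l by (simp add: LIM_zero tendsto_norm_zero)
      then show "\<exists>l\<in>V ` E. (\<lambda>n. hnorm (s n - l)) \<longlonglongrightarrow> 0" using lE by blast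
    qed
  qed
qed

text \<open>The indefinite product \<open>cinner (J x) y\<close> transported by \<open>V\<close>. It
  vanishes off the range because elements of \<open>\<N>\<close> have to satisfy
  \<open>zero_outside\<close>.\<close>

definition image_form :: "('a::complex_hilbert \<Rightarrow> 'a) \<Rightarrow> ('a \<Rightarrow> 'a) \<Rightarrow> 'a \<Rightarrow> 'a \<Rightarrow> complex" where
  "image_form V J x y =
     (if x \<in> range V \<and> y \<in> range V then cinner (J (inv V x)) (inv V y) else 0)"

lemma image_form_apply: "inj V \<Longrightarrow> image_form V J (V a) (V b) = cinner (J a) b"
  by (simp add: image_form_def)

text \<open>The eigenspaces of \<open>J\<close> for 1 and -1 are mapped to a fundamental
  decomposition: \<open>V\<close> is isometric on each up to the sign of the form, and the halves of
  \<open>a + J a\<close> and \<open>a - J a\<close> split any \<open>a\<close>.\<close>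

lemma krein_space_image_form:
  fixes V J :: "'a::complex_hilbert \<Rightarrow> 'a"
  assumes V: "clinear V" "inj V" and J: "symmetric J" "\<And>x. J (J x) = x"
  shows "krein_space (range V) (image_form V J)"
proof -
  note JL = symmetric_imp_clinear[OF J(1)]
  note app = image_form_apply[OF V(2)]
  have cont: "continuous_on UNIV J"
    by (intro linear_continuous_on symmetric_involution_bounded_linear[OF J])
  have herm: "hermitian_on (range V) (image_form V J)"
    unfolding hermitian_on_def
  proof (intro conjI ballI allI)
    fix x y z assume "x \<in> range V" "y \<in> range V" "z \<in> range V"
    then show "image_form V J (x + y) z = image_form V J x z + image_form V J y z"
      by (auto simp: app clinear_add[OF JL] cinner_expand simp flip: clinear_add[OF V(1)])
  next
    fix a x y assume "x \<in> range V" "y \<in> range V"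
    then show "image_form V J (a *\<^sub>C x) y = a * image_form V J x y"
      by (auto simp: app clinear_scaleC[OF JL] cinner_expand simp flip: clinear_scaleC[OF V(1)])
  next
    fix x y assume "x \<in> range V" "y \<in> range V"
    then obtain a b where "x = V a" "y = V b" by blast
    then show "image_form V J y x = cnj (image_form V J x y)"
      using cinner_commute[of "J a" b] by (simp add: app symmetricD[OF J(1), of b a])
  qed
  let ?P = "{a. J a = a}" and ?N = "{a. J a = - a}"
  have P: "csubspace ?P" "closed ?P"
    using closed_Collect_eq[OF cont continuous_on_id]
    by (simp_all add: complex_vector.subspace_def clinear_zero[OF JL] clinear_add[OF JL] clinear_scaleC[OF JL])
  have N: "csubspace ?N" "closed ?N"
    using closed_Collect_eq[OF cont continuous_on_minus[OF continuous_on_id]]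
    by (simp_all add: complex_vector.subspace_def clinear_zero[OF JL] clinear_add[OF JL] clinear_scaleC[OF JL])
  have "fundamental_decomposition (range V) (image_form V J) (V ` ?P) (V ` ?N)"
    unfolding fundamental_decomposition_def
  proof (intro conjI ballI)
    show "hilbert_on (V ` ?P) (image_form V J)"
      by (rule hilbert_form_imp_hilbert_on, rule hilbert_form_image[OF V(1) P]) (simp add: app)
    show "hilbert_on (V ` ?N) (\<lambda>x y. - image_form V J x y)"
      by (rule hilbert_form_imp_hilbert_on, rule hilbert_form_image[OF V(1) N]) (simp add: app cinner_expand)
    show "V ` ?P \<inter> V ` ?N = {0}"
    proof -
      have "V 0 = 0" "J 0 = 0" using clinear_zero V(1) JL by auto
      moreover have "a = 0" if aP: "a \<in> ?P" and aN: "V a \<in> V ` ?N" for a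
      proof -
        obtain b where "V a = V b" "J b = - b" using aN by blast
        then have "J a = - a" using injD[OF V(2)] by metis
        then have "a = - a" using aP by simp
        then have "2 *\<^sub>R a = 0" by (simp add: scaleR_2 add_eq_0_iff)
        then show ?thesis by simp
      qed
      ultimately show ?thesis by (intro equalityI subsetI) (auto intro!: image_eqI[of 0 V 0])
    qed
    show "range V = {x + y |x y. x \<in> V ` ?P \<and> y \<in> V ` ?N}"
    proof (intro equalityI subsetI)
      fix x assume "x \<in> range V"
      then obtain a where a: "x = V a" by blast
      let ?p = "(1/2) *\<^sub>R (a + J a)" and ?n = "(1/2) *\<^sub>R (a - J a)"
      have "?p + ?n = a" by (simp add: algebra_simps flip: scaleR_add_left)
      then have "x = V ?p + V ?n" using a clinear_add[OF V(1)] by metis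
      moreover have "?p \<in> ?P" "?n \<in> ?N"
        by (simp_all add: clinear_scaleR[OF JL] clinear_add[OF JL] clinear_diff[OF JL] J(2) algebra_simps)
      ultimately show "x \<in> {x + y |x y. x \<in> V ` ?P \<and> y \<in> V ` ?N}" by blast
    qed (auto simp flip: clinear_add[OF V(1)])
    fix x y assume "x \<in> V ` ?P" "y \<in> V ` ?N"
    then obtain a b where ab: "x = V a" "y = V b" "J a = a" "J b = - b" by blast
    then have "cinner a b = - cinner a b" using symmetricD[OF J(1), of a b] by (simp add: cinner_expand)
    then show "image_form V J x y = 0" using ab by (simp add: app)
  qed
  moreover have "csubspace (range V)" by (intro csubspace_image V complex_vector.subspace_UNIV)
  ultimately show ?thesis using herm by (auto simp: krein_space_def)
qed

text \<open>\<open>W\<close> is the adjoint of \<open>V\<close>. Pulled back by \<open>V\<close>,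
  the vector \<open>S u\<close> becomes \<open>J (W u)\<close>; the \<open>J\<close> in the form
  cancels the one in front, and \<open>cinner (W u) b\<close> is \<open>cinner u (V b)\<close>. So
  the range of \<open>V\<close> represents \<open>S\<close>.\<close>

lemma (in invertible_self_adjoint) factorization_in_completions:
  assumes V: "clinear V" "inj V" and J: "symmetric J" "\<And>x. J (J x) = x"
    and adj: "\<And>x u. cinner (V x) u = cinner x (W u)" and S: "\<And>u. S u = V (J (W u))"
  shows "(range V, image_form V J, T |` {x \<in> dom T. the (T x) \<in> range V}) \<in> \<N> T"
proof (rule representing_in_completions)
  show "krein_space (range V) (image_form V J)" by (rule krein_space_image_form[OF V J])
  show "dom T \<subseteq> range V" unfolding range_S[symmetric] using S by auto
  show "image_form V J (S u) y = cinner u y" if y: "y \<in> range V" for u y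
  proof -
    obtain b where b: "y = V b" using y by blast
    have "image_form V J (S u) y = cinner (W u) b" by (simp add: S b image_form_apply[OF V(2)] J(2))
    also have "\<dots> = cinner u (V b)" using adj[of b u] cinner_commute by metis
    finally show ?thesis using b by simp
  qed
  show "zero_outside (range V) (image_form V J)" by (simp add: zero_outside_def image_form_def)
qed


section \<open>Square roots and signs of bounded operators\<close>

text \<open>Cauchy-Schwarz for the semidefinite form \<open>cinner (D x) y\<close> at
  \<open>u\<close> and \<open>D u\<close> bounds the fourth power of \<open>norm (D u)\<close> by
  the squares of \<open>M\<close>, \<open>M\<close>-free factors \<open>norm u\<close> and
  \<open>norm (D u)\<close> multiplied together; cancelling the last one gives the claim.\<close>

lemma norm_le_if_form_le:
  fixes D :: "'a::complex_hilbert \<Rightarrow>\<^sub>L 'a"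
  assumes sym: "symmetric D" and M: "0 \<le> M"
    and lo: "\<And>u. 0 \<le> Re (cinner (D u) u)" and hi: "\<And>u. Re (cinner (D u) u) \<le> M * (norm u)\<^sup>2"
  shows "norm D \<le> M"
proof (rule norm_blinfun_bound[OF M])
  fix u
  interpret semidefinite_form UNIV "\<lambda>x y. cinner (D x) y"
  proof
    note L = symmetric_imp_clinear[OF sym]
    show "hermitian_on UNIV (\<lambda>x y. cinner (D x) y)"
      unfolding hermitian_on_def
    proof (intro conjI ballI allI)
      show "cinner (D y) x = cnj (cinner (D x) y)" for x y
        by (metis cinner_commute symmetricD[OF sym])
    qed (simp_all add: clinear_add[OF L] clinear_scaleC[OF L] cinner_expand)
  qed (simp_all add: lo complex_vector.subspace_UNIV)
  have "(norm (D u))\<^sup>2 * (norm (D u))\<^sup>2 = (cmod (cinner (D u) (D u)))\<^sup>2"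
    by (simp add: cinner_self power2_eq_square norm_mult)
  also have "\<dots> \<le> Re (cinner (D u) u) * Re (cinner (D (D u)) (D u))"
    by (rule Cauchy_Schwarz_power2) simp_all
  also have "\<dots> \<le> (M * (norm u)\<^sup>2) * (M * (norm (D u))\<^sup>2)"
    by (intro mult_mono hi lo mult_nonneg_nonneg M) simp
  finally have *: "(norm (D u))\<^sup>2 * (norm (D u))\<^sup>2 \<le> (M * norm u)\<^sup>2 * (norm (D u))\<^sup>2"
    by (simp add: power2_eq_square mult_ac)
  show "norm (D u) \<le> M * norm u"
  proof (cases "D u = 0")
    case False
    then have "(norm (D u))\<^sup>2 \<le> (M * norm u)\<^sup>2" by (intro mult_right_le_imp_le[OF *]) simp
    then show ?thesis by (rule power2_le_imp_le) (simp add: M)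
  qed (simp add: M)
qed

text \<open>A fixed point Y of this recursion satisfies 2 Y = D + Y Y, which says that 1 - Y is a
  square root of 1 - D.\<close>

primrec sqrt_iter :: "('a::complex_hilbert \<Rightarrow>\<^sub>L 'a) \<Rightarrow> nat \<Rightarrow> ('a \<Rightarrow>\<^sub>L 'a)" where
  "sqrt_iter D 0 = 0"
| "sqrt_iter D (Suc n) = (1/2) *\<^sub>R (D + (sqrt_iter D n o\<^sub>L sqrt_iter D n))"

primrec sqrt_bound :: "nat \<Rightarrow> real" where
  "sqrt_bound 0 = 0"
| "sqrt_bound (Suc n) = (1 + (sqrt_bound n)\<^sup>2) / 2"

lemma sqrt_bound_range: "0 \<le> sqrt_bound n \<and> sqrt_bound n \<le> 1"
proof (induction n)
  case (Suc n)
  then have "(sqrt_bound n)\<^sup>2 \<le> 1" by (simp add: power_le_one)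
  then show ?case by simp
qed simp

lemma sqrt_bound_Suc: "sqrt_bound n \<le> sqrt_bound (Suc n)"
  using zero_le_power2[of "1 - sqrt_bound n"] by (simp add: power2_diff)

text \<open>With \<open>norm D \<le> 1\<close> the iterates for \<open>1 - sqrt (1 - D)\<close> are dominated by
  the scalar iterates for \<open>D = 1\<close>, which increase and stay below 1. So no contraction is needed.\<close>

lemma sqrt_iter_le:
  assumes "norm D \<le> 1"
  shows "norm (sqrt_iter D n) \<le> sqrt_bound n"
    and "norm (sqrt_iter D (Suc n) - sqrt_iter D n) \<le> sqrt_bound (Suc n) - sqrt_bound n"
proof -
  show le: "norm (sqrt_iter D n) \<le> sqrt_bound n" for n
  proof (induction n)
    case (Suc n)
    have "norm (sqrt_iter D n o\<^sub>L sqrt_iter D n) \<le> sqrt_bound n * sqrt_bound n"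
      by (rule order_trans[OF norm_blinfun_compose]) (intro mult_mono Suc, auto simp: sqrt_bound_range)
    then have "norm (D + (sqrt_iter D n o\<^sub>L sqrt_iter D n)) \<le> 1 + sqrt_bound n * sqrt_bound n"
      using assms by (intro norm_triangle_le add_mono)
    then show ?case by (simp add: power2_eq_square)
  qed simp
  show "norm (sqrt_iter D (Suc n) - sqrt_iter D n) \<le> sqrt_bound (Suc n) - sqrt_bound n" for n
  proof (induction n)
    case 0 then show ?case using assms by simp
  next
    case (Suc n)
    let ?Y = "sqrt_iter D n" and ?Z = "sqrt_iter D (Suc n)"
    let ?y = "sqrt_bound n" and ?z = "sqrt_bound (Suc n)"
    \<comment> \<open>This splitting respects the order of the factors, and the scalar bounds of its
      two terms add up to exactly \<open>?z\<^sup>2 - ?y\<^sup>2\<close>.\<close>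
    have "(?Z o\<^sub>L ?Z) - (?Y o\<^sub>L ?Y) = (?Z o\<^sub>L (?Z - ?Y)) + ((?Z - ?Y) o\<^sub>L ?Y)"
      by (intro blinfun_eqI) (simp only: blinfun.diff_left blinfun.add_left blinfun.diff_right
          blinfun_apply_blinfun_compose diff_add_cancel add_diff_eq)
    also have "norm \<dots> \<le> ?z * (?z - ?y) + (?z - ?y) * ?y"
    proof (rule order_trans[OF norm_triangle_ineq], rule add_mono)
      show "norm (?Z o\<^sub>L (?Z - ?Y)) \<le> ?z * (?z - ?y)"
        by (rule order_trans[OF norm_blinfun_compose], rule mult_mono[OF le Suc])
          (auto simp: sqrt_bound_range simp del: sqrt_bound.simps)
      show "norm ((?Z - ?Y) o\<^sub>L ?Y) \<le> (?z - ?y) * ?y"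
        by (rule order_trans[OF norm_blinfun_compose], rule mult_mono[OF Suc le])
          (use sqrt_bound_Suc[of n] in \<open>auto simp del: sqrt_bound.simps\<close>)
    qed
    also have "\<dots> = ?z\<^sup>2 - ?y\<^sup>2" by (simp only: power2_eq_square) (simp only: algebra_simps)
    finally have *: "norm ((?Z o\<^sub>L ?Z) - (?Y o\<^sub>L ?Y)) \<le> ?z\<^sup>2 - ?y\<^sup>2" .
    have "sqrt_iter D (Suc (Suc n)) - ?Z = (1/2) *\<^sub>R ((?Z o\<^sub>L ?Z) - (?Y o\<^sub>L ?Y))"
      unfolding sqrt_iter.simps(2)[of D "Suc n"] by (subst (2) sqrt_iter.simps(2)) (simp only: scaleR_diff_right[symmetric] add_diff_cancel_left)
    then have "norm (sqrt_iter D (Suc (Suc n)) - ?Z) \<le> (?z\<^sup>2 - ?y\<^sup>2) / 2" using * by simp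
    also have "\<dots> = sqrt_bound (Suc (Suc n)) - sqrt_bound (Suc n)"
      unfolding sqrt_bound.simps(2)[of "Suc n"] by (subst (3) sqrt_bound.simps(2)) (simp add: field_simps)
    finally show ?case .
  qed
qed

text \<open>The increments are dominated by those of \<open>sqrt_bound\<close>, which is increasing
  and bounded, hence Cauchy.\<close>

lemma sqrt_iter_convergent:
  assumes "norm D \<le> 1" obtains Y where "sqrt_iter D \<longlonglongrightarrow> Y"
proof -
  have tel: "norm (sqrt_iter D (n + k) - sqrt_iter D n) \<le> sqrt_bound (n + k) - sqrt_bound n" for n k
  proof (induction k)
    case (Suc k)
    have "norm (sqrt_iter D (n + Suc k) - sqrt_iter D n)
        \<le> norm (sqrt_iter D (Suc (n + k)) - sqrt_iter D (n + k)) + norm (sqrt_iter D (n + k) - sqrt_iter D n)"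
      using norm_triangle_ineq[of "sqrt_iter D (Suc (n + k)) - sqrt_iter D (n + k)" "sqrt_iter D (n + k) - sqrt_iter D n"]
      by (simp only: add_Suc_right diff_add_cancel add_diff_eq)
    then show ?case using Suc sqrt_iter_le(2)[OF assms, of "n + k"]
      by (simp only: add_Suc_right)
  qed simp
  have "convergent sqrt_bound"
    by (rule Bseq_mono_convergent)
      (auto intro!: BseqI'[of _ 1] lift_Suc_mono_le[of sqrt_bound, OF sqrt_bound_Suc] simp: sqrt_bound_range simp del: sqrt_bound.simps)
  then have C: "Cauchy sqrt_bound" by (rule convergent_Cauchy)
  have "Cauchy (sqrt_iter D)"
    unfolding Cauchy_altdef2
  proof (intro allI impI)
    fix e :: real assume "e > 0"
    then obtain N where N: "\<And>n. n \<ge> N \<Longrightarrow> dist (sqrt_bound n) (sqrt_bound N) < e"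
      using C unfolding Cauchy_altdef2 by blast
    have "dist (sqrt_iter D n) (sqrt_iter D N) < e" if "n \<ge> N" for n
      using tel[of N "n - N"] N[OF that] that by (simp add: dist_norm)
    then show "\<exists>N. \<forall>n\<ge>N. dist (sqrt_iter D n) (sqrt_iter D N) < e" by blast
  qed
  then show ?thesis using that by (auto simp: Cauchy_convergent_iff convergent_def)
qed

text \<open>\<open>X\<close> is \<open>1 - Y\<close> for the limit \<open>Y\<close>, and positivity
  comes from \<open>norm Y \<le> 1\<close>. The iterates are polynomials in \<open>D\<close>, so
  symmetry, and commutation with any \<open>B\<close> that commutes with \<open>D\<close>, survive
  in the limit.\<close>

lemma positive_sqrt:
  fixes D :: "'a::complex_hilbert \<Rightarrow>\<^sub>L 'a"
  assumes D: "norm D \<le> 1" and sym: "symmetric D"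
  obtains X :: "'a \<Rightarrow>\<^sub>L 'a" where "symmetric X" "\<And>u. X (X u) = u - D u"
    "\<And>u. 0 \<le> Re (cinner (X u) u)"
    "\<And>(B :: 'a \<Rightarrow>\<^sub>L 'a) u. (\<And>u. B (D u) = D (B u)) \<Longrightarrow> B (X u) = X (B u)"
proof -
  obtain Y where Y: "sqrt_iter D \<longlonglongrightarrow> Y" by (rule sqrt_iter_convergent[OF D])
  have Yu: "(\<lambda>n. sqrt_iter D n u) \<longlonglongrightarrow> Y u" for u
    by (intro blinfun.tendsto Y tendsto_const)
  have Y1: "norm Y \<le> 1"
    by (rule LIMSEQ_le_const2[OF tendsto_norm[OF Y]])
      (use sqrt_iter_le(1)[OF D] sqrt_bound_range order_trans in blast)
  have "(\<lambda>n. sqrt_iter D (Suc n)) \<longlonglongrightarrow> (1/2) *\<^sub>R (D + (Y o\<^sub>L Y))"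
    unfolding sqrt_iter.simps
    by (intro tendsto_intros bounded_bilinear.tendsto[OF bounded_bilinear_blinfun_compose] Y)
  then have "Y = (1/2) *\<^sub>R (D + (Y o\<^sub>L Y))" using LIMSEQ_Suc[OF Y] LIMSEQ_unique by blast
  from arg_cong[OF this, of "\<lambda>Z. 2 *\<^sub>R Z"] have "2 *\<^sub>R Y = D + (Y o\<^sub>L Y)" by simp
  then have fix_eq: "2 *\<^sub>R Y u = D u + Y (Y u)" for u
    by (metis blinfun.add_left blinfun.scaleR_left blinfun_apply_blinfun_compose)
  have symn: "cinner (sqrt_iter D n x) y = cinner x (sqrt_iter D n y)" for n x y
    by (induction n arbitrary: x y)
      (simp_all add: blinfun.add_left blinfun.scaleR_left cinner_expand symmetricD[OF sym])
  have symY: "cinner (Y x) y = cinner x (Y y)" for x y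
  proof (rule LIMSEQ_unique)
    show "(\<lambda>n. cinner (sqrt_iter D n x) y) \<longlonglongrightarrow> cinner (Y x) y"
      by (intro bounded_bilinear.tendsto[OF bounded_bilinear_cinner] Yu tendsto_const)
    show "(\<lambda>n. cinner (sqrt_iter D n x) y) \<longlonglongrightarrow> cinner x (Y y)"
      unfolding symn by (intro bounded_bilinear.tendsto[OF bounded_bilinear_cinner] Yu tendsto_const)
  qed
  define X where "X = id_blinfun - Y"
  have X: "X u = u - Y u" for u by (simp add: X_def blinfun.diff_left)
  show ?thesis
  proof (rule that[of X])
    show "symmetric X" by (simp add: symmetric_def X cinner_expand symY)
    show "X (X u) = u - D u" for u
      using fix_eq[of u] by (simp add: X blinfun.diff_right scaleR_2 algebra_simps)
    show "0 \<le> Re (cinner (X u) u)" for u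
    proof -
      have "norm (Y u) \<le> norm u"
        using norm_blinfun[of Y u] mult_right_mono[OF Y1 norm_ge_zero[of u]] by simp
      then have "norm (Y u) * norm u \<le> (norm u)\<^sup>2" by (simp add: power2_eq_square mult_right_mono)
      moreover have "Re (cinner (Y u) u) \<le> norm (Y u) * norm u"
        using cmod_cinner_le complex_Re_le_cmod order_trans by blast
      ultimately show ?thesis by (simp add: X cinner_expand cinner_self)
    qed
    show "B (X u) = X (B u)" if B: "\<And>u. B (D u) = D (B u)" for B :: "'a \<Rightarrow>\<^sub>L 'a" and u
    proof -
      have Bn: "B (sqrt_iter D n v) = sqrt_iter D n (B v)" for n v
        by (induction n arbitrary: v)
          (simp_all add: blinfun.add_left blinfun.add_right blinfun.scaleR_left blinfun.scaleR_right B)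
      have "B (Y u) = Y (B u)"
      proof (rule LIMSEQ_unique)
        show "(\<lambda>n. B (sqrt_iter D n u)) \<longlonglongrightarrow> B (Y u)" by (intro blinfun.tendsto tendsto_const Yu)
        show "(\<lambda>n. B (sqrt_iter D n u)) \<longlonglongrightarrow> Y (B u)" unfolding Bn by (rule Yu)
      qed
      then show ?thesis by (simp add: X blinfun.diff_right)
    qed
  qed
qed

text \<open>Equal norms make the map from \<open>A u\<close> to \<open>S u\<close> well defined and
  isometric on a dense set. The limit of \<open>S (v n)\<close> is the same for all sequences with
  \<open>A (v n)\<close> tending to \<open>x\<close>; taken as the value at \<open>x\<close>, it
  inherits linearity and the norm.\<close>

lemma isometric_extension:
  fixes A S :: "'a::complex_hilbert \<Rightarrow>\<^sub>L 'a"
  assumes iso: "\<And>u. norm (S u) = norm (A u)" and dense: "closure (range A) = UNIV"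
  obtains J :: "'a \<Rightarrow>\<^sub>L 'a" where "\<And>u. J (A u) = S u"
proof -
  have "\<exists>j. \<forall>v. (\<lambda>n. A (v n)) \<longlonglongrightarrow> x \<longrightarrow> (\<lambda>n. S (v n)) \<longlonglongrightarrow> j" for x
  proof -
    have "x \<in> closure (range A)" using dense by simp
    then obtain y where y: "\<And>n. y n \<in> range A" "y \<longlonglongrightarrow> x" unfolding closure_sequential by blast
    then have "\<forall>n. \<exists>u. y n = A u" by blast
    then obtain u where "\<And>n. y n = A (u n)" by metis
    then have "y = (\<lambda>n. A (u n))" by blast
    with y have u: "(\<lambda>n. A (u n)) \<longlonglongrightarrow> x" by simp
    have "dist (S (u m)) (S (u n)) = dist (A (u m)) (A (u n))" for m n
      by (simp add: dist_norm iso flip: blinfun.diff_right)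
    then have "Cauchy (\<lambda>n. S (u n))" using LIMSEQ_imp_Cauchy[OF u] by (simp add: Cauchy_def)
    then obtain j where j: "(\<lambda>n. S (u n)) \<longlonglongrightarrow> j" by (auto simp: Cauchy_convergent_iff convergent_def)
    have "(\<lambda>n. S (v n)) \<longlonglongrightarrow> j" if v: "(\<lambda>n. A (v n)) \<longlonglongrightarrow> x" for v
    proof -
      have "(\<lambda>n. norm (A (v n) - A (u n))) \<longlonglongrightarrow> norm (x - x)" by (intro tendsto_intros u v)
      then have "(\<lambda>n. norm (S (v n) - S (u n))) \<longlonglongrightarrow> 0"
        by (simp add: iso flip: blinfun.diff_right)
      then have "(\<lambda>n. S (v n) - S (u n)) \<longlonglongrightarrow> 0" by (rule tendsto_norm_zero_cancel)
      from tendsto_add[OF this j] show ?thesis by simp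
    qed
    then show ?thesis by blast
  qed
  then obtain f where f: "\<And>x v. (\<lambda>n. A (v n)) \<longlonglongrightarrow> x \<Longrightarrow> (\<lambda>n. S (v n)) \<longlonglongrightarrow> f x" by metis
  have seq: "\<exists>v. (\<lambda>n. A (v n)) \<longlonglongrightarrow> x" for x
  proof -
    have "x \<in> closure (range A)" using dense by simp
    then obtain y where y: "\<And>n. y n \<in> range A" "y \<longlonglongrightarrow> x" unfolding closure_sequential by blast
    then have "\<forall>n. \<exists>u. y n = A u" by blast
    then obtain u where "\<And>n. y n = A (u n)" by metis
    then have "y = (\<lambda>n. A (u n))" by blast
    with y show ?thesis by auto
  qed
  have "bounded_linear f"
  proof
    fix x y
    obtain v w where vw: "(\<lambda>n. A (v n)) \<longlonglongrightarrow> x" "(\<lambda>n. A (w n)) \<longlonglongrightarrow> y" using seq by meson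
    have "(\<lambda>n. A (v n + w n)) \<longlonglongrightarrow> x + y" unfolding blinfun.add_right by (intro tendsto_add vw)
    from f[OF this] have "(\<lambda>n. S (v n) + S (w n)) \<longlonglongrightarrow> f (x + y)" by (simp add: blinfun.add_right)
    then show "f (x + y) = f x + f y" using tendsto_add[OF f[OF vw(1)] f[OF vw(2)]] LIMSEQ_unique by blast
  next
    fix r x
    obtain v where v: "(\<lambda>n. A (v n)) \<longlonglongrightarrow> x" using seq by meson
    have "(\<lambda>n. A (r *\<^sub>R v n)) \<longlonglongrightarrow> r *\<^sub>R x" unfolding blinfun.scaleR_right by (intro tendsto_intros v)
    from f[OF this] have "(\<lambda>n. r *\<^sub>R S (v n)) \<longlonglongrightarrow> f (r *\<^sub>R x)" by (simp add: blinfun.scaleR_right)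
    then show "f (r *\<^sub>R x) = r *\<^sub>R f x" using tendsto_scaleR[OF tendsto_const f[OF v]] LIMSEQ_unique by blast
  next
    have "norm (f x) = norm x" for x
    proof -
      obtain v where v: "(\<lambda>n. A (v n)) \<longlonglongrightarrow> x" using seq by meson
      from tendsto_norm[OF f[OF v]] tendsto_norm[OF v] show ?thesis
        unfolding iso by (rule LIMSEQ_unique)
    qed
    then show "\<exists>K. \<forall>x. norm (f x) \<le> norm x * K" by (intro exI[of _ 1]) simp
  qed
  moreover have "f (A u) = S u" for u
    using f[of "\<lambda>n. u" "A u"] LIMSEQ_unique[OF tendsto_const] by force
  ultimately show ?thesis using that[of "Blinfun f"] by (simp add: bounded_linear_Blinfun_apply)
qed

lemma blinfun_eq_on_dense:
  fixes f g :: "'a::real_normed_vector \<Rightarrow>\<^sub>L 'b::real_normed_vector"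
  assumes "closure X = UNIV" "\<And>x. x \<in> X \<Longrightarrow> f x = g x"
  shows "f x = g x"
proof -
  have "continuous_on UNIV (\<lambda>x. f x - g x)" by (intro continuous_intros)
  then have "f x - g x = 0"
    using assms continuous_constant_on_closure[of X "\<lambda>x. f x - g x" 0 x] by simp
  then show ?thesis by simp
qed

lemma dense_range_compose:
  fixes f g :: "'a::real_normed_vector \<Rightarrow>\<^sub>L 'a"
  assumes "closure (range f) = UNIV" "closure (range g) = UNIV"
  shows "closure (range (\<lambda>x. f (g x))) = UNIV"
proof -
  have "f ` closure (range g) \<subseteq> closure (f ` range g)"
    by (rule image_closure_subset) (auto intro!: continuous_intros simp: closure_subset)
  then have "range f \<subseteq> closure (range (\<lambda>x. f (g x)))" using assms by (simp add: image_image)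
  then have "closure (range f) \<subseteq> closure (range (\<lambda>x. f (g x)))" by (simp add: closure_minimal)
  then show ?thesis using assms by auto
qed

text \<open>Q is the square root of the modulus of S, and J is the sign of S.\<close>

lemma sign_factorization:
  fixes S :: "'a::complex_hilbert \<Rightarrow> 'a"
  assumes bl: "bounded_linear S" and sym: "symmetric S" and dense: "closure (range S) = UNIV"
  obtains Q J :: "'a \<Rightarrow>\<^sub>L 'a" where "symmetric Q" "symmetric J" "\<And>x. J (J x) = x"
    "\<And>x. J (Q x) = Q (J x)" "\<And>x. S x = Q (J (Q x))"
proof -
  \<comment> \<open>The summand 1 keeps \<open>c\<close> positive even when \<open>S\<close>
    vanishes. Division by \<open>c\<close> brings the norm to at most 1, which the square root
    iteration requires.\<close>
  define c where "c = norm (Blinfun S) + 1"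
  have c: "c > 0" by (simp add: c_def add_nonneg_pos)
  define R where "R = (1 / c) *\<^sub>R Blinfun S"
  have R: "R x = (1 / c) *\<^sub>R S x" for x by (simp add: R_def blinfun.scaleR_left bounded_linear_Blinfun_apply[OF bl])
  have SR: "S x = c *\<^sub>R R x" for x using c by (simp add: R)
  have normR: "norm R \<le> 1" using c by (simp add: R_def) (simp add: c_def)
  have symR: "symmetric R" using sym by (simp add: symmetric_def R cinner_expand)
  have "range R = (\<lambda>x. (1 / c) *\<^sub>R x) ` range S" by (auto simp: R)
  then have denseR: "closure (range R) = UNIV"
  proof (simp only: closure_scaleR[symmetric] dense)
    have "x \<in> range ((*\<^sub>R) (1 / c))" for x :: 'a
      using c by (intro range_eqI[of _ _ "c *\<^sub>R x"]) simp
    then show "range ((*\<^sub>R) (1 / c)) = (UNIV :: 'a set)" by blast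
  qed
  have norm_le: "norm (R u) \<le> norm u" for u
    using norm_blinfun[of R u] mult_right_mono[OF normR norm_ge_zero[of u]] by simp
  \<comment> \<open>\<open>1 - D\<close> is the square of \<open>R\<close>, so its root
    \<open>A\<close> is the modulus of \<open>R\<close>. In the same way \<open>E = 1 - A\<close>
    leads to the root \<open>P\<close> of \<open>A\<close> below.\<close>
  define D where "D = id_blinfun - (R o\<^sub>L R)"
  have Du: "D u = u - R (R u)" for u by (simp add: D_def blinfun.diff_left)
  have symD: "symmetric D" by (simp add: symmetric_def Du cinner_expand symmetricD[OF symR])
  have formD: "Re (cinner (D u) u) = (norm u)\<^sup>2 - (norm (R u))\<^sup>2" for u
    by (simp add: Du cinner_expand cinner_self symmetricD[OF symR, of "R u"])
  have "norm D \<le> 1"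
    by (rule norm_le_if_form_le[OF symD]) (simp_all add: formD norm_le)
  then obtain A :: "'a \<Rightarrow>\<^sub>L 'a" where A: "symmetric A" "\<And>u. A (A u) = u - D u" "\<And>u. 0 \<le> Re (cinner (A u) u)"
    "\<And>(B :: 'a \<Rightarrow>\<^sub>L 'a) u. (\<And>u. B (D u) = D (B u)) \<Longrightarrow> B (A u) = A (B u)"
    using symD by (rule positive_sqrt) blast
  have AA: "A (A u) = R (R u)" for u by (simp add: A(2) Du)
  have RA: "R (A u) = A (R u)" for u by (rule A(4)) (simp add: Du blinfun.diff_right)
  have normA: "norm (R u) = norm (A u)" for u
  proof -
    have "cinner (A u) (A u) = cinner (R u) (R u)"
      by (simp add: symmetricD[OF A(1)] symmetricD[OF symR] AA)
    then show ?thesis by (simp add: cinner_self flip: of_real_power)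
  qed
  define E where "E = id_blinfun - A"
  have Eu: "E u = u - A u" for u by (simp add: E_def blinfun.diff_left)
  have symE: "symmetric E" by (simp add: symmetric_def Eu cinner_expand symmetricD[OF A(1)])
  have "norm E \<le> 1"
  proof (rule norm_le_if_form_le[OF symE])
    fix u
    have "Re (cinner (A u) u) \<le> norm (A u) * norm u"
      using cmod_cinner_le complex_Re_le_cmod order_trans by blast
    also have "\<dots> \<le> norm u * norm u" using norm_le[of u] by (intro mult_right_mono) (simp_all add: normA)
    finally show "0 \<le> Re (cinner (E u) u)" by (simp add: Eu cinner_expand cinner_self power2_eq_square)
    show "Re (cinner (E u) u) \<le> 1 * (norm u)\<^sup>2" using A(3)[of u] by (simp add: Eu cinner_expand cinner_self)
  qed simp
  then obtain P :: "'a \<Rightarrow>\<^sub>L 'a" where P: "symmetric P" "\<And>u. P (P u) = u - E u"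
    "\<And>(B :: 'a \<Rightarrow>\<^sub>L 'a) u. (\<And>u. B (E u) = E (B u)) \<Longrightarrow> B (P u) = P (B u)"
    using symE by (rule positive_sqrt) blast
  have PP: "P (P u) = A u" for u by (simp add: P(2) Eu)
  have RP: "R (P u) = P (R u)" for u by (rule P(3)) (simp add: Eu blinfun.diff_right RA)
  have AP: "A (P u) = P (A u)" for u by (rule P(3)) (simp add: Eu blinfun.diff_right)
  have denseAA: "closure (range (\<lambda>x. A (A x))) = UNIV"
    unfolding AA by (rule dense_range_compose[OF denseR denseR])
  have denseA: "closure (range A) = UNIV"
    using closure_mono[of "range (\<lambda>x. A (A x))" "range A"] denseAA by auto
  \<comment> \<open>Polar decomposition: \<open>R\<close> and its modulus \<open>A\<close> have
    equal norms, and \<open>J\<close> carries one to the other.\<close>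
  obtain J :: "'a \<Rightarrow>\<^sub>L 'a" where J: "\<And>u. J (A u) = R u"
    using isometric_extension[of R A] normA denseA by blast
  have symJ: "symmetric J"
  proof -
    have 1: "cinner (J (A u)) (A v) = cinner (A u) (J (A v))" for u v
      by (simp add: J symmetricD[OF A(1)] symmetricD[OF symR] RA)
    have 2: "cinner (J x) (A v) = cinner x (J (A v))" for x v
    proof -
      have "continuous_on UNIV (\<lambda>x. cinner (J x) (A v) - cinner x (J (A v)))"
        by (intro continuous_intros bounded_bilinear.continuous_on[OF bounded_bilinear_cinner])
      then have "cinner (J x) (A v) - cinner x (J (A v)) = 0"
        using 1 denseA continuous_constant_on_closure[of "range A" "\<lambda>x. cinner (J x) (A v) - cinner x (J (A v))" 0 x] by auto
      then show ?thesis by simp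
    qed
    have "cinner (J x) y = cinner x (J y)" for x y
    proof -
      have "continuous_on UNIV (\<lambda>y. cinner (J x) y - cinner x (J y))"
        by (intro continuous_intros bounded_bilinear.continuous_on[OF bounded_bilinear_cinner])
      then have "cinner (J x) y - cinner x (J y) = 0"
        using 2 denseA continuous_constant_on_closure[of "range A" "\<lambda>y. cinner (J x) y - cinner x (J y)" 0 y] by auto
      then show ?thesis by simp
    qed
    then show ?thesis by (simp add: symmetric_def)
  qed
  have JJ: "J (J x) = x" for x
  proof -
    \<comment> \<open>As \<open>R\<close> and \<open>A\<close> commute, two applications of
      \<open>J\<close> turn both factors \<open>A\<close> into \<open>R\<close>, and
      \<open>R (R u)\<close> is \<open>A (A u)\<close> again.\<close>
    have "J (J (A (A u))) = A (A u)" for u by (simp only: J RA) (simp only: J AA)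
    then show ?thesis
      using blinfun_eq_on_dense[OF denseAA, of "J o\<^sub>L J" id_blinfun x] by auto
  qed
  have JP: "J (P x) = P (J x)" for x
  proof -
    have "J (P (A u)) = P (J (A u))" for u by (simp only: J RP flip: AP)
    then show ?thesis
      using blinfun_eq_on_dense[OF denseA, of "J o\<^sub>L P" "P o\<^sub>L J" x] by auto
  qed
  have PJP: "P (J (P u)) = R u" for u by (simp only: JP[symmetric] PP J)
  define Q where "Q = sqrt c *\<^sub>R P"
  have Q: "Q u = sqrt c *\<^sub>R P u" for u by (simp add: Q_def blinfun.scaleR_left)
  show ?thesis
  proof (rule that[of Q J])
    show "symmetric Q" using P(1) by (simp add: symmetric_def Q cinner_expand)
    show "J (Q x) = Q (J x)" for x by (simp add: Q blinfun.scaleR_right JP)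
    show "S x = Q (J (Q x))" for x
      using c by (simp add: Q blinfun.scaleR_right PJP SR)
  qed (fact symJ JJ)+
qed


section \<open>Operators that are not semibounded\<close>

lemma cinner_suminf_left: "summable f \<Longrightarrow> cinner (suminf f) y = (\<Sum>n. cinner (f n) y)"
  by (rule bounded_linear.suminf[OF bounded_bilinear.bounded_linear_left[OF bounded_bilinear_cinner]])

lemma cinner_suminf_right: "summable f \<Longrightarrow> cinner y (suminf f) = (\<Sum>n. cinner y (f n))"
  by (rule bounded_linear.suminf[OF bounded_bilinear.bounded_linear_right[OF bounded_bilinear_cinner]])

lemma scaleC_suminf: "summable f \<Longrightarrow> c *\<^sub>C suminf f = (\<Sum>n. c *\<^sub>C f n)"
  by (rule bounded_linear.suminf[OF bounded_linear_scaleC])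

lemma blinfun_scaleC: "symmetric (blinfun_apply A) \<Longrightarrow> blinfun_apply A (c *\<^sub>C x) = c *\<^sub>C blinfun_apply A x"
  by (rule clinear_scaleC[OF symmetric_imp_clinear])

text \<open>Orthogonalization against vectors of the range of Q costs only a multiple of
  \<open>norm (Q a)\<close>, since \<open>cinner a (Q g) = cinner (Q a) g\<close>.\<close>

lemma small_orthogonal_vector:
  fixes Q :: "'a::complex_hilbert \<Rightarrow>\<^sub>L 'a"
  assumes Q: "symmetric Q" and E: "csubspace E"
    and small: "\<And>\<epsilon>. \<epsilon> > 0 \<Longrightarrow> \<exists>a\<in>E \<inter> range Q. norm (Q a) < \<epsilon> * norm a"
    and F: "finite F" "F \<subseteq> E \<inter> range Q" "\<And>x. x \<in> F \<Longrightarrow> norm x = 1"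
      "\<And>x y. x \<in> F \<Longrightarrow> y \<in> F \<Longrightarrow> x \<noteq> y \<Longrightarrow> cinner x y = 0"
    and \<epsilon>: "\<epsilon> > 0"
  obtains b where "b \<in> E \<inter> range Q" "norm b = 1" "norm (Q b) \<le> \<epsilon>" "\<And>x. x \<in> F \<Longrightarrow> cinner b x = 0"
proof -
  have "\<forall>x\<in>F. \<exists>g. x = Q g" using F(2) by blast
  then obtain g where g: "\<And>x. x \<in> F \<Longrightarrow> x = Q (g x)" by metis
  define G where "G = (\<Sum>x\<in>F. norm (g x))"
  have G: "G \<ge> 0" by (simp add: G_def sum_nonneg)
  \<comment> \<open>The first bound keeps \<open>norm c\<close> below half of \<open>norm a\<close>,
    so that \<open>b\<close> retains at least half of that norm; the second keeps
    \<open>norm (Q b)\<close> below \<open>\<epsilon> / 2 * norm a\<close>.\<close>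
  define \<delta> where "\<delta> = min (1 / (2 * (G + 1))) (\<epsilon> / (2 * (1 + norm Q * G)))"
  have NG: "0 \<le> norm Q * G" using G by simp
  have \<delta>: "\<delta> > 0" unfolding \<delta>_def min_less_iff_conj using G NG \<epsilon> by (intro conjI divide_pos_pos mult_pos_pos) linarith+
  have \<delta>1: "\<delta> * G \<le> 1 / 2"
  proof -
    have "\<delta> * G \<le> 1 / (2 * (G + 1)) * G" using G by (intro mult_right_mono) (simp_all add: \<delta>_def)
    also have "\<dots> \<le> 1 / 2" using G by (simp add: field_simps)
    finally show ?thesis .
  qed
  have \<delta>2: "(1 + norm Q * G) * \<delta> \<le> \<epsilon> / 2"
  proof -
    have "(1 + norm Q * G) * \<delta> \<le> (1 + norm Q * G) * (\<epsilon> / (2 * (1 + norm Q * G)))"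
      using NG by (intro mult_left_mono) (simp_all add: \<delta>_def)
    also have "\<dots> = \<epsilon> / 2" using NG by (simp add: field_simps)
    finally show ?thesis .
  qed
  obtain a where a: "a \<in> E" "a \<in> range Q" "norm (Q a) < \<delta> * norm a" using small[OF \<delta>] by blast
  define c where "c = (\<Sum>x\<in>F. cinner a x *\<^sub>C x)"
  have rQ: "csubspace (range Q)"
    by (intro csubspace_image symmetric_imp_clinear Q complex_vector.subspace_UNIV)
  have "csubspace (E \<inter> range Q)" using E rQ by (rule complex_vector.subspace_inter)
  note sub = this
  have cE: "c \<in> E \<inter> range Q"
    unfolding c_def using F(2) by (intro complex_vector.subspace_sum[OF sub] complex_vector.subspace_scale[OF sub]) blast
  have "norm c \<le> (\<Sum>x\<in>F. norm (Q a) * norm (g x))"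
    unfolding c_def
  proof (rule sum_norm_le)
    fix x assume x: "x \<in> F"
    have "cinner a x = cinner (Q a) (g x)" using g[OF x] symmetricD[OF Q] by metis
    then show "norm (cinner a x *\<^sub>C x) \<le> norm (Q a) * norm (g x)"
      using cmod_cinner_le[of "Q a" "g x"] F(3)[OF x] by simp
  qed
  then have nc: "norm c \<le> norm (Q a) * G" by (simp add: G_def sum_distrib_left)
  define b where "b = a - c"
  have bE: "b \<in> E \<inter> range Q" unfolding b_def using a cE by (intro complex_vector.subspace_diff[OF sub]) auto
  have orth: "cinner b x = 0" if x: "x \<in> F" for x
  proof -
    have "cinner c x = (\<Sum>y\<in>F. cinner (cinner a y *\<^sub>C y) x)"
      unfolding c_def by (intro linear_sum bounded_linear.linear bounded_bilinear.bounded_linear_left bounded_bilinear_cinner)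
    also have "\<dots> = (\<Sum>y\<in>F. if y = x then cinner a x else 0)"
      using F(3,4) x by (intro sum.cong) (auto simp: cinner_expand cinner_self)
    also have "\<dots> = cinner a x" using F(1) x by simp
    finally show ?thesis by (simp add: b_def cinner_expand)
  qed
  have "norm c \<le> \<delta> * norm a * G" using nc a(3) G mult_right_mono[of "norm (Q a)" "\<delta> * norm a" G] by simp
  also have "\<dots> \<le> norm a / 2" using mult_right_mono[OF \<delta>1, of "norm a"] by (simp add: mult_ac)
  finally have nb: "norm a / 2 \<le> norm b" using norm_triangle_ineq2[of a c] by (simp add: b_def)
  have "norm (Q b) \<le> norm (Q a) + norm (Q c)" by (simp add: b_def blinfun.diff_right norm_triangle_ineq4)
  also have "\<dots> \<le> norm (Q a) + norm Q * (norm (Q a) * G)"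
    using norm_blinfun[of Q c] mult_left_mono[OF nc norm_ge_zero[of Q]] by simp
  also have "\<dots> = (1 + norm Q * G) * norm (Q a)" by (simp add: algebra_simps)
  also have "\<dots> \<le> (1 + norm Q * G) * (\<delta> * norm a)" using a(3) NG by (intro mult_left_mono) simp_all
  also have "\<dots> \<le> \<epsilon> / 2 * norm a" using mult_right_mono[OF \<delta>2, of "norm a"] by (simp add: mult_ac)
  also have "\<dots> \<le> \<epsilon> * norm b" using mult_left_mono[OF nb, of \<epsilon>] \<epsilon> by simp
  finally have Qb: "norm (Q b) \<le> \<epsilon> * norm b" .
  have "a \<noteq> 0" using a(3) by auto
  then have nb0: "norm b > 0" using nb by (metis half_gt_zero less_le_trans zero_less_norm_iff)
  show ?thesis
  proof (rule that[of "of_real (1 / norm b) *\<^sub>C b"])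
    show "of_real (1 / norm b) *\<^sub>C b \<in> E \<inter> range Q" by (rule complex_vector.subspace_scale[OF sub bE])
    show "norm (of_real (1 / norm b) *\<^sub>C b) = 1" using nb0 by (simp add: scaleC_of_real del: of_real_divide)
    show "norm (Q (of_real (1 / norm b) *\<^sub>C b)) \<le> \<epsilon>"
      using nb0 Qb by (simp add: scaleC_of_real blinfun.scaleR_right field_simps del: of_real_divide)
    show "cinner (of_real (1 / norm b) *\<^sub>C b) x = 0" if "x \<in> F" for x
      using orth[OF that] by (simp add: cinner_expand)
  qed
qed

text \<open>Vectors are added one at a time to a finite orthonormal set. The choice is made for
  every set \<open>F\<close>, with \<open>good F\<close> as a premise, so that a total function
  \<open>c\<close> can be iterated; \<open>good\<close> is recovered by induction.\<close>

lemma small_orthonormal_sequence: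
  fixes Q :: "'a::complex_hilbert \<Rightarrow>\<^sub>L 'a" and \<epsilon> :: "nat \<Rightarrow> real"
  assumes Q: "symmetric Q" and E: "csubspace E"
    and small: "\<And>\<epsilon>. \<epsilon> > 0 \<Longrightarrow> \<exists>a\<in>E \<inter> range Q. norm (Q a) < \<epsilon> * norm a"
    and \<epsilon>: "\<And>n. \<epsilon> n > 0"
  obtains e :: "nat \<Rightarrow> 'a" where "\<And>n. e n \<in> E \<inter> range Q" "\<And>n. norm (Q (e n)) \<le> \<epsilon> n"
    "\<And>m n. cinner (e m) (e n) = (if m = n then 1 else 0)"
proof -
  define good where "good F \<longleftrightarrow> finite F \<and> F \<subseteq> E \<inter> range Q \<and> (\<forall>x\<in>F. norm x = 1) \<and>
    (\<forall>x\<in>F. \<forall>y\<in>F. x \<noteq> y \<longrightarrow> cinner x y = 0)" for F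
  have "\<exists>b. good F \<longrightarrow> b \<in> E \<inter> range Q \<and> norm b = 1 \<and> norm (Q b) \<le> \<epsilon> n \<and> (\<forall>x\<in>F. cinner b x = 0)" for F n
  proof (cases "good F")
    case True
    obtain b where "b \<in> E \<inter> range Q" "norm b = 1" "norm (Q b) \<le> \<epsilon> n" "\<And>x. x \<in> F \<Longrightarrow> cinner b x = 0"
      by (rule small_orthogonal_vector[OF Q E small, of F "\<epsilon> n"]) (use True \<epsilon> in \<open>auto simp: good_def\<close>)
    then show ?thesis by blast
  qed blast
  then obtain c where c: "\<And>F n. good F \<Longrightarrow> c F n \<in> E \<inter> range Q \<and> norm (c F n) = 1 \<and>
      norm (Q (c F n)) \<le> \<epsilon> n \<and> (\<forall>x\<in>F. cinner (c F n) x = 0)" by metis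
  define F where "F = rec_nat {} (\<lambda>n F. insert (c F n) F)"
  define e where "e n = c (F n) n" for n
  have F_Suc: "F (Suc n) = insert (e n) (F n)" for n by (simp add: F_def e_def)
  have F_eq: "F n = e ` {..<n}" for n
    by (induction n) (simp_all add: F_Suc lessThan_Suc, simp add: F_def)
  have good: "good (F n)" for n
  proof (induction n)
    case 0 show ?case by (simp add: F_def good_def)
  next
    case (Suc n)
    have "cinner x (e n) = 0" if "x \<in> F n" for x
      using c[OF Suc, of n] that cinner_commute[of x "e n"] by (simp add: e_def)
    then show ?case using Suc c[OF Suc, of n] by (auto simp: good_def F_Suc e_def)
  qed
  have lt: "cinner (e n) (e m) = 0" if "m < n" for m n
    using c[OF good, of n] that F_eq[of n] by (auto simp: e_def)
  show ?thesis
  proof (rule that[of e])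
    show "e n \<in> E \<inter> range Q" "norm (Q (e n)) \<le> \<epsilon> n" for n using c[OF good, of n] by (auto simp: e_def)
    have "cinner (e n) (e n) = 1" for n using c[OF good, of n] by (simp add: cinner_self e_def)
    then show "cinner (e m) (e n) = (if m = n then 1 else 0)" for m n
      using lt[of m n] lt[of n m] cinner_commute[of "e m" "e n"] by (cases m n rule: linorder_cases) auto
  qed
qed

text \<open>With u = T x and Q J Q u = x, the hypothesis \<open>unb\<close> says that T has no upper
  bound. Splitting \<open>Q u\<close> into eigenvectors \<open>a\<close> and \<open>b\<close> of
  \<open>J\<close> bounds the form by \<open>(norm a)\<^sup>2\<close>, while \<open>Q a\<close> and
  \<open>Q b\<close> stay orthogonal because \<open>Q\<close> commutes with \<open>J\<close>. So a
  large form makes \<open>a\<close> large compared with \<open>Q a\<close>.\<close>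

lemma unbounded_form_sequence:
  fixes Q J :: "'a::complex_hilbert \<Rightarrow>\<^sub>L 'a" and \<epsilon> :: "nat \<Rightarrow> real"
  assumes Q: "symmetric Q" and J: "symmetric J" "\<And>x. J (J x) = x" "\<And>x. J (Q x) = Q (J x)"
    and unb: "\<And>c. \<exists>u. c * (norm (Q (J (Q u))))\<^sup>2 < Re (cinner u (Q (J (Q u))))"
    and \<epsilon>: "\<And>n. \<epsilon> n > 0"
  obtains e :: "nat \<Rightarrow> 'a" where "\<And>n. e n \<in> range Q" "\<And>n. J (e n) = e n" "\<And>n. norm (Q (e n)) \<le> \<epsilon> n"
    "\<And>m n. cinner (e m) (e n) = (if m = n then 1 else 0)"
proof -
  let ?E = "{a. J a = a}"
  have E: "csubspace ?E"
    by (simp add: complex_vector.subspace_def blinfun.add_right blinfun_scaleC[OF J(1)])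
  have small: "\<exists>a\<in>?E \<inter> range Q. norm (Q a) < \<eta> * norm a" if \<eta>: "\<eta> > 0" for \<eta> :: real
  proof -
    define c where "c = 1 / \<eta>\<^sup>2"
    have c: "c > 0" using \<eta> by (simp add: c_def)
    obtain u where u: "c * (norm (Q (J (Q u))))\<^sup>2 < Re (cinner u (Q (J (Q u))))" using unb by blast
    define a b where "a = (1/2) *\<^sub>R (Q u + J (Q u))" and "b = (1/2) *\<^sub>R (Q u - J (Q u))"
    have Ja: "J a = a" and Jb: "J b = - b"
      by (simp_all add: a_def b_def blinfun.scaleR_right blinfun.add_right blinfun.diff_right J(2) algebra_simps)
    have ab: "a + b = Q u" "a - b = J (Q u)"
      by (simp_all add: a_def b_def algebra_simps flip: scaleR_add_left)
    have orth: "cinner x y = 0" if "J x = x" "J y = - y" for x y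
      using symmetricD[OF J(1), of x y] that by (simp add: cinner_expand)
    have "Re (cinner u (Q (J (Q u)))) = Re (cinner (a + b) (a - b))"
      by (simp add: ab symmetricD[OF Q])
    also have "\<dots> = (norm a)\<^sup>2 - (norm b)\<^sup>2"
      using orth[OF Ja Jb] cinner_commute[of b a] by (simp add: cinner_expand cinner_self)
    finally have 1: "Re (cinner u (Q (J (Q u)))) \<le> (norm a)\<^sup>2" by simp
    have o2: "cinner (Q a) (Q b) = 0"
      by (rule orth) (simp_all add: J(3) Ja Jb blinfun.minus_right)
    have "(norm (Q (a - b)))\<^sup>2 = (norm (Q a))\<^sup>2 + (norm (Q b))\<^sup>2"
      using o2 cinner_commute[of "Q b" "Q a"]
      by (simp add: norm_power2_eq_cinner blinfun.diff_right cinner_expand)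
    then have 2: "(norm (Q a))\<^sup>2 \<le> (norm (Q (J (Q u))))\<^sup>2" by (simp add: ab)
    have "c * (norm (Q a))\<^sup>2 < (norm a)\<^sup>2"
      using u 1 mult_left_mono[OF 2, of c] c by linarith
    then have "(norm (Q a))\<^sup>2 < (\<eta> * norm a)\<^sup>2"
      using \<eta> by (simp add: c_def field_simps power_mult_distrib)
    then have "norm (Q a) < \<eta> * norm a" by (rule power2_less_imp_less) (use \<eta> in simp)
    moreover have "a = Q ((1/2) *\<^sub>R (u + J u))"
      by (simp add: a_def blinfun.scaleR_right blinfun.add_right J(3))
    ultimately show ?thesis using Ja by blast
  qed
  show ?thesis
  proof (rule small_orthonormal_sequence[of Q ?E \<epsilon>, OF Q E small \<epsilon>])
    fix e :: "nat \<Rightarrow> 'a"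
    assume "\<And>n. e n \<in> ?E \<inter> range Q" "\<And>n. norm (Q (e n)) \<le> \<epsilon> n"
      "\<And>m n. cinner (e m) (e n) = (if m = n then 1 else 0)"
    then show ?thesis by (intro that[of e]) auto
  qed
qed

context invertible_self_adjoint
begin

lemma symmetric_S: "symmetric S"
  by (simp add: symmetric_def S_symmetric)

lemma factorization:
  obtains Q J :: "'a \<Rightarrow>\<^sub>L 'a" where "symmetric Q" "symmetric J" "\<And>x. J (J x) = x"
    "\<And>x. J (Q x) = Q (J x)" "\<And>x. S x = Q (J (Q x))" "inj Q"
proof -
  obtain Q J :: "'a \<Rightarrow>\<^sub>L 'a" where *: "symmetric Q" "symmetric J" "\<And>x. J (J x) = x"
    "\<And>x. J (Q x) = Q (J x)" "\<And>x. S x = Q (J (Q x))"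
    by (rule sign_factorization[OF bounded_linear_S symmetric_S]) (use range_S dense_dom in auto)
  have "inj Q" by (rule injI) (metis *(5) inj_S)
  with * show ?thesis by (rule that)
qed

lemma completion_exists: "\<exists>k. k \<in> \<N> T"
proof -
  obtain Q J :: "'a \<Rightarrow>\<^sub>L 'a" where *: "symmetric Q" "symmetric J" "\<And>x. J (J x) = x"
    "\<And>x. J (Q x) = Q (J x)" "\<And>x. S x = Q (J (Q x))" "inj Q" by (rule factorization) blast
  show ?thesis
    using factorization_in_completions[OF symmetric_imp_clinear[OF *(1)] *(6,2,3) symmetricD[OF *(1)] *(5)] by blast
qed

text \<open>The second completion is the range of \<open>Q (1 + N)\<close>, where N is the unbounded nilpotent
  operator \<open>\<i> \<Sum> 4 ^ n (\<cdot>, p n) q n\<close>. As \<open>J p = q\<close>, and the q are orthogonal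
  to the p, the operator \<open>1 + N\<close> formally preserves the form of J, and so \<open>Q (1 + N)\<close> gives
  a factorization of S again. It is bounded since \<open>Q (q n)\<close> is small.\<close>

lemma distinct_completions:
  assumes "\<not> semibounded T"
  obtains K ip A K' ip' A' where "(K, ip, A) \<in> \<N> T" "(K', ip', A') \<in> \<N> T" "K \<noteq> K'"
proof -
  obtain Q J :: "'a \<Rightarrow>\<^sub>L 'a" where Q: "symmetric Q" and J: "symmetric J" "\<And>x. J (J x) = x"
    and JQ: "\<And>x. J (Q x) = Q (J x)" and S: "\<And>x. S x = Q (J (Q x))" and inj: "inj Q" by (rule factorization) blast
  note QL = symmetric_imp_clinear[OF Q]
  have above: "\<exists>u. c * (norm (Q (J (Q u))))\<^sup>2 < Re (cinner u (Q (J (Q u))))" for c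
  proof -
    obtain x where "x \<in> dom T" "c * (norm x)\<^sup>2 < Re (cinner (the (T x)) x)"
      using assms unfolding semibounded_def semibounded_above_def by (meson not_le)
    then show ?thesis by (intro exI[of _ "the (T x)"]) (simp flip: S)
  qed
  \<comment> \<open>Passing to \<open>- J\<close> exchanges the eigenspaces and the sign of
    \<open>S\<close>, so the missing lower bound yields a sequence in the other eigenspace.\<close>
  have below: "\<exists>u. c * (norm (Q ((- J) (Q u))))\<^sup>2 < Re (cinner u (Q ((- J) (Q u))))" for c
  proof -
    obtain x where "x \<in> dom T" "Re (cinner (the (T x)) x) < - c * (norm x)\<^sup>2"
      using assms unfolding semibounded_def semibounded_below_def by (meson not_le)
    then show ?thesis
      by (intro exI[of _ "the (T x)"]) (simp add: blinfun.minus_left blinfun.minus_right cinner_expand flip: S)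
  qed
  \<comment> \<open>Against the weight \<open>4 ^ n\<close> this decay leaves
    \<open>(1/2) ^ n\<close>, so the series defining the perturbation of \<open>Q\<close>
    converge.\<close>
  have eps: "(0::real) < (1/8) ^ n" for n :: nat by simp
  obtain e :: "nat \<Rightarrow> 'a" where e: "\<And>n. e n \<in> range Q" "\<And>n. J (e n) = e n" "\<And>n. norm (Q (e n)) \<le> (1/8) ^ n"
    "\<And>m n. cinner (e m) (e n) = (if m = n then 1 else 0)"
    by (rule unbounded_form_sequence[of Q J "\<lambda>n. (1/8) ^ n", OF Q J JQ above eps]) blast
  have nJ: "symmetric (- J)" using J(1) by (simp add: symmetric_def blinfun.minus_left cinner_expand)
  have nJJ: "(- J) ((- J) x) = x" for x by (simp add: blinfun.minus_left blinfun.minus_right J(2))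
  have nJQ: "(- J) (Q x) = Q ((- J) x)" for x by (simp add: blinfun.minus_left blinfun.minus_right JQ)
  obtain f :: "nat \<Rightarrow> 'a" where f: "\<And>n. f n \<in> range Q" "\<And>n. (- J) (f n) = f n" "\<And>n. norm (Q (f n)) \<le> (1/8) ^ n"
    "\<And>m n. cinner (f m) (f n) = (if m = n then 1 else 0)"
    by (rule unbounded_form_sequence[of Q "- J" "\<lambda>n. (1/8) ^ n", OF Q nJ nJJ nJQ below eps]) blast
  have Jf: "J (f n) = - f n" for n using f(2)[of n] by (simp add: blinfun.minus_left) (metis minus_minus)
  have ef: "cinner (e m) (f n) = 0" for m n
    using symmetricD[OF J(1), of "e m" "f n"] by (simp add: e(2) Jf cinner_expand)
  have fe: "cinner (f n) (e m) = 0" for m n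
    using ef[of m n] cinner_commute[of "f n" "e m"] by simp
  \<comment> \<open>These vectors are neutral for the form of \<open>J\<close>: \<open>J\<close>
    swaps \<open>p n\<close> and \<open>q n\<close>, and the two are orthogonal.\<close>
  define p q where "p n = e n + f n" and "q n = e n - f n" for n
  have Jp: "J (p n) = q n" and Jq: "J (q n) = p n" for n
    by (simp_all add: p_def q_def blinfun.add_right blinfun.diff_right e(2) Jf)
  have pp: "cinner (p m) (p n) = (if m = n then 2 else 0)" and qq: "cinner (q m) (q n) = (if m = n then 2 else 0)"
    and qp: "cinner (q m) (p n) = 0" and pq: "cinner (p m) (q n) = 0" for m n
    by (simp_all add: p_def q_def cinner_expand e(4) f(4) ef fe)
  have np: "norm (p n) \<le> 2" and nq: "norm (q n) \<le> 2" for n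
  proof -
    have "norm (e n) = 1" "norm (f n) = 1"
      using norm_power2_eq_cinner[of "e n"] norm_power2_eq_cinner[of "f n"] e(4)[of n n] f(4)[of n n]
      by (simp_all add: power2_eq_1_iff) (use norm_ge_zero in \<open>smt (verit)\<close>)+
    then show "norm (p n) \<le> 2" "norm (q n) \<le> 2"
      unfolding p_def q_def using norm_triangle_ineq[of "e n" "f n"] norm_triangle_ineq4[of "e n" "f n"] by auto
  qed
  have nQq: "norm (Q (q n)) \<le> 2 * (1/8) ^ n" for n
    unfolding q_def blinfun.diff_right
    using norm_triangle_ineq4[of "Q (e n)" "Q (f n)"] e(3)[of n] f(3)[of n] by linarith
  have rQ: "csubspace (range Q)" by (intro csubspace_image QL complex_vector.subspace_UNIV)
  have "p n \<in> range Q" "q n \<in> range Q" for n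
    unfolding p_def q_def by (intro complex_vector.subspace_add[OF rQ] complex_vector.subspace_diff[OF rQ] e f)+
  then have "\<forall>n. \<exists>x. p n = Q x" "\<forall>n. \<exists>x. q n = Q x" by blast+
  \<comment> \<open>Pairing with \<open>g m\<close> and \<open>h m\<close> strips \<open>Q\<close>
    from \<open>V\<close>, since \<open>Q (g m)\<close> is \<open>p m\<close> and
    \<open>Q (h m)\<close> is \<open>q m\<close>.\<close>
  then obtain g h where g: "\<And>n. p n = Q (g n)" and h: "\<And>n. q n = Q (h n)" by metis

  define a where "a u n = (4 ^ n * cinner u (p n)) *\<^sub>C Q (q n)" for u and n :: nat
  define b where "b u n = (4 ^ n * cinner u (Q (q n))) *\<^sub>C p n" for u and n :: nat
  have geo: "summable (\<lambda>n. C * (1/2) ^ n)" for C :: real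
    by (intro summable_mult summable_geometric) simp
  have bound: "cmod (4 ^ n * z) * r \<le> 4 * norm u * (1/2) ^ n"
    if "cmod z * r \<le> norm u * (4 * (1/8) ^ n)" for z r and u :: 'a and n
  proof -
    have "cmod (4 ^ n * z) * r = 4 ^ n * (cmod z * r)" by (simp add: norm_mult norm_power)
    also have "\<dots> \<le> 4 ^ n * (norm u * (4 * (1/8) ^ n))" using that by (intro mult_left_mono) auto
    also have "\<dots> = 4 * norm u * (4 * (1/8)) ^ n" by (simp only: power_mult_distrib mult_ac)
    finally show ?thesis by simp
  qed
  have sa: "summable (a u)" for u
  proof (rule summable_comparison_test'[OF geo[of "4 * norm u"], of 0])
    fix n
    have "cmod (cinner u (p n)) * norm (Q (q n)) \<le> (norm u * 2) * (2 * (1/8) ^ n)"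
      by (intro mult_mono nQq order_trans[OF cmod_cinner_le] mult_left_mono np) auto
    then show "norm (a u n) \<le> 4 * norm u * (1/2) ^ n"
      unfolding a_def norm_scaleC by (intro bound) simp
  qed
  have sb: "summable (b u)" for u
  proof (rule summable_comparison_test'[OF geo[of "4 * norm u"], of 0])
    fix n
    have "cmod (cinner u (Q (q n))) * norm (p n) \<le> (norm u * (2 * (1/8) ^ n)) * 2"
      by (intro mult_mono nQq order_trans[OF cmod_cinner_le] mult_left_mono np) auto
    then show "norm (b u n) \<le> 4 * norm u * (1/2) ^ n"
      unfolding b_def norm_scaleC by (intro bound) simp
  qed
  \<comment> \<open>Here \<open>N\<close> is \<open>Q\<close> times the nilpotent operator, without
    the factor \<i>; it is defined everywhere, and \<open>N'\<close> is its adjoint.\<close>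
  define N N' where "N u = suminf (a u)" and "N' u = suminf (b u)" for u
  have N_cinner: "cinner (N x) y = (\<Sum>n. 4 ^ n * cinner x (p n) * cinner (Q (q n)) y)" for x y
    unfolding N_def by (simp add: cinner_suminf_left[OF sa]) (simp add: a_def cinner_expand)
  have N'_cinner: "cinner x (N' y) = (\<Sum>n. 4 ^ n * cinner x (p n) * cinner (Q (q n)) y)" for x y
  proof -
    have "cinner x (b y n) = 4 ^ n * cinner x (p n) * cinner (Q (q n)) y" for n
      unfolding b_def cinner_expand using cinner_commute[of "Q (q n)" y] by simp
    then show ?thesis unfolding N'_def by (simp add: cinner_suminf_right[OF sb])
  qed
  have NL: "clinear N"
    unfolding clinear_def
  proof (intro conjI allI)
    show "N (x + y) = N x + N y" for x y
    proof -
      have "a (x + y) = (\<lambda>n. a x n + a y n)"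
        by (rule ext) (simp add: a_def cinner_expand distrib_left scaleC_add_left)
      then show ?thesis by (simp add: N_def suminf_add[OF sa sa])
    qed
    show "N (c *\<^sub>C x) = c *\<^sub>C N x" for c x
    proof -
      have "a (c *\<^sub>C x) = (\<lambda>n. c *\<^sub>C a x n)"
        by (rule ext) (simp add: a_def cinner_expand scaleC_scaleC mult_ac)
      then show ?thesis by (simp add: N_def scaleC_suminf[OF sa])
    qed
  qed
  have N_eq_0: "N u = 0" if "\<And>m. cinner u (p m) = 0" for u
  proof -
    have "a u = (\<lambda>n. 0)" by (rule ext) (simp add: a_def that)
    then show ?thesis by (simp add: N_def)
  qed
  define V where "V u = Q u + \<i> *\<^sub>C N u" for u
  define W where "W u = Q u - \<i> *\<^sub>C N' u" for u
  have VL: "clinear V"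
    using NL QL unfolding clinear_def V_def by (simp add: scaleC_add_right scaleC_scaleC mult.commute)
  have adj: "cinner (V x) y = cinner x (W y)" for x y
    by (simp add: V_def W_def cinner_expand N_cinner N'_cinner symmetricD[OF Q])
  have V_Q: "cinner (V u) x = cinner u (Q x) + \<i> * (\<Sum>n. 4 ^ n * cinner u (p n) * cinner (q n) (Q x))" for u x
    by (simp add: V_def cinner_expand N_cinner symmetricD[OF Q])
  have injV: "inj V"
  proof (rule injI)
    fix x y assume xy: "V x = V y"
    define u where "u = x - y"
    have Vu: "V u = 0" using xy by (simp add: u_def clinear_diff[OF VL])
    \<comment> \<open>The \<open>p m\<close> are orthogonal to all \<open>q n\<close>, so pairing
      with \<open>g m\<close> annihilates the perturbation and sees only \<open>u\<close>.\<close>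
    have up: "cinner u (p m) = 0" for m
      using V_Q[of u "g m"] by (simp add: Vu qp flip: g)
    then have "N u = 0" by (rule N_eq_0)
    then have "Q u = Q 0" using Vu by (simp add: V_def)
    then have "u = 0" using inj by (simp only: inj_eq)
    then show "x = y" by (simp add: u_def)
  qed
  have SV: "S u = V (J (W u))" for u
  proof -
    \<comment> \<open>\<open>M\<close> is a series in the \<open>q n\<close>, which \<open>N\<close>
      annihilates, and \<open>Q M\<close> equals \<open>N (J (Q u))\<close>. So in
      \<open>V (J (W u))\<close> the two first-order perturbations cancel and the second-order one
      vanishes.\<close>
    define M where "M = J (N' u)"
    have JN: "summable (\<lambda>n. J (b u n))" and M: "M = (\<Sum>n. J (b u n))"
      unfolding M_def N'_def by (rule bounded_linear.summable[OF blinfun.bounded_linear_right sb],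
          rule bounded_linear.suminf[OF blinfun.bounded_linear_right sb])
    have Jb: "J (b u n) = (4 ^ n * cinner u (Q (q n))) *\<^sub>C q n" for n
      by (simp add: b_def blinfun_scaleC[OF J(1)] Jp)
    have "cinner M (p m) = 0" for m
      unfolding M cinner_suminf_left[OF JN] by (simp add: Jb cinner_expand qp)
    then have NM: "N M = 0" by (rule N_eq_0)
    have "Q M = (\<Sum>n. Q (J (b u n)))"
      unfolding M by (rule bounded_linear.suminf[OF blinfun.bounded_linear_right JN])
    also have "\<dots> = (\<Sum>n. a (J (Q u)) n)"
      by (simp add: Jb a_def blinfun_scaleC[OF Q] symmetricD[OF J(1)] symmetricD[OF Q] Jp)
    finally have QM: "Q M = N (J (Q u))" by (simp add: N_def)
    have JW: "J (W u) = J (Q u) - \<i> *\<^sub>C M"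
      by (simp add: W_def M_def blinfun.diff_right blinfun_scaleC[OF J(1)])
    have "V (J (W u)) = V (J (Q u)) - \<i> *\<^sub>C V M"
      by (simp add: JW clinear_diff[OF VL] clinear_scaleC[OF VL])
    also have "\<dots> = S u" by (simp add: V_def NM QM S)
    finally show ?thesis by simp
  qed
  have K1: "(range Q, image_form Q J, T |` {x \<in> dom T. the (T x) \<in> range Q}) \<in> \<N> T"
    by (rule factorization_in_completions[OF QL inj J symmetricD[OF Q] S])
  have K2: "(range V, image_form V J, T |` {x \<in> dom T. the (T x) \<in> range V}) \<in> \<N> T"
    by (rule factorization_in_completions[OF VL injV J adj SV])
  have "range Q \<noteq> range V"
  proof
    assume eq: "range Q = range V"
    \<comment> \<open>The coefficients \<open>(1/2) ^ n\<close> make the series converge, but under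
      the weight \<open>4 ^ n\<close> they grow. If \<open>V u = Q w\<close>, then
      \<open>cinner w (q m)\<close> has modulus \<open>4 * 2 ^ m\<close>, too large for any fixed
      \<open>w\<close>.\<close>
    define u where "u = (\<Sum>n. (1/2) ^ n *\<^sub>R p n)"
    have su: "summable (\<lambda>n. (1/2) ^ n *\<^sub>R p n)"
    proof (rule summable_comparison_test'[OF geo[of 2], of 0])
      show "norm ((1/2) ^ n *\<^sub>R p n) \<le> 2 * (1/2) ^ n" for n
        using mult_right_mono[OF np, of "(1/2) ^ n" n] by (simp add: mult.commute)
    qed
    have up: "cinner u (p m) = 2 * (1/2) ^ m" for m
    proof -
      have "cinner u (p m) = (\<Sum>n. if n = m then 2 * (1/2) ^ m else 0)"
        unfolding u_def cinner_suminf_left[OF su] by (intro suminf_cong) (simp add: cinner_expand pp)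
      also have "\<dots> = 2 * (1/2) ^ m"
        by (rule sums_unique[symmetric]) (rule sums_single)
      finally show ?thesis .
    qed
    have uq: "cinner u (q m) = 0" for m
      unfolding u_def cinner_suminf_left[OF su] by (simp add: cinner_expand pq)
    obtain w where w: "V u = Q w" using eq by blast
    have wq: "cinner w (q m) = \<i> * (4 * 2 ^ m)" for m
    proof -
      have "cinner w (q m) = cinner (V u) (h m)" by (simp add: w symmetricD[OF Q] h)
      also have "\<dots> = \<i> * (\<Sum>n. 4 ^ n * cinner u (p n) * cinner (q n) (q m))"
        unfolding V_Q by (simp add: uq flip: h)
      also have "(\<Sum>n. 4 ^ n * cinner u (p n) * cinner (q n) (q m)) = (\<Sum>n. if n = m then 4 * 2 ^ m else 0)"
      proof (intro suminf_cong)
        have "(4::complex) ^ m = 2 ^ m * 2 ^ m" by (simp flip: power_mult_distrib)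
        then show "4 ^ n * cinner u (p n) * cinner (q n) (q m) = (if n = m then 4 * 2 ^ m else 0)" for n
          by (simp add: up qq power_one_over)
      qed
      also have "\<dots> = 4 * 2 ^ m" by (rule sums_unique[symmetric]) (rule sums_single)
      finally show ?thesis .
    qed
    have "2 * 2 ^ m \<le> norm w" for m :: nat
    proof -
      have "4 * 2 ^ m = cmod (cinner w (q m))" unfolding wq by (simp add: norm_mult norm_power)
      also have "\<dots> \<le> norm w * norm (q m)" by (rule cmod_cinner_le)
      also have "\<dots> \<le> norm w * 2" by (intro mult_left_mono nq) simp
      finally show ?thesis by simp
    qed
    moreover obtain m :: nat where "norm w < 2 ^ m" using real_arch_pow[of 2 "norm w"] by auto
    ultimately show False by (smt (verit) zero_le_power)
  qed
  with K1 K2 show ?thesis by (rule that)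
qed

end


section \<open>Semibounded operators\<close>

lemma (in krein_form) ip_tendsto:
  assumes s: "\<And>n. s n \<in> K" "x \<in> K" "(\<lambda>n. H.hnorm (s n - x)) \<longlonglongrightarrow> 0"
    and r: "\<And>n. r n \<in> K" "y \<in> K" "(\<lambda>n. H.hnorm (r n - y)) \<longlonglongrightarrow> 0"
  shows "(\<lambda>n. ip (s n) (r n)) \<longlonglongrightarrow> ip x y"
proof -
  let ?d = "\<lambda>n. ip (s n - x) y + ip x (r n - y) + ip (s n - x) (r n - y)"
  have eq: "ip (s n) (r n) = ip x y + ?d n" for n
    using s(1,2) r(1,2) by (simp add: K.expand)
  have 1: "(\<lambda>n. ip (s n - x) y) \<longlonglongrightarrow> 0"
    by (rule Lim_null_comparison[OF always_eventually tendsto_mult_left_zero[OF s(3), of "H.hnorm y"]])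
      (use s r in \<open>simp add: Cauchy_Schwarz_ip\<close>)
  have 2: "(\<lambda>n. ip x (r n - y)) \<longlonglongrightarrow> 0"
    by (rule Lim_null_comparison[OF always_eventually tendsto_mult_right_zero[OF r(3), of "H.hnorm x"]])
      (use s r in \<open>simp add: Cauchy_Schwarz_ip\<close>)
  have 3: "(\<lambda>n. ip (s n - x) (r n - y)) \<longlonglongrightarrow> 0"
    by (rule Lim_null_comparison[OF always_eventually tendsto_mult_zero[OF s(3) r(3)]])
      (use s r in \<open>simp add: Cauchy_Schwarz_ip\<close>)
  have "(\<lambda>n. ip x y + ?d n) \<longlonglongrightarrow> ip x y + (0 + 0 + 0)"
    by (intro tendsto_intros 1 2 3)
  then show ?thesis by (simp add: eq)
qed

text \<open>By symmetry the two bounds on \<open>G\<close> place \<open>D\<close>, which is 1 minus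
  the scaled square of \<open>G\<close>, between 0 and a constant below 1. A fixed point
  \<open>x\<close> of the contraction adding \<open>v\<close> to \<open>D x\<close> exhibits
  \<open>v\<close> as a multiple of \<open>G (G x)\<close>.\<close>

lemma symmetric_bounded_below_surj:
  fixes G :: "'a::complex_hilbert \<Rightarrow> 'a"
  assumes bl: "bounded_linear G" and sym: "symmetric G" and \<epsilon>: "\<epsilon> > 0"
    and below: "\<And>u. \<epsilon> * norm u \<le> norm (G u)"
  shows "surj G"
proof -
  define B where "B = Blinfun G"
  have B: "B u = G u" for u by (simp add: B_def bounded_linear_Blinfun_apply[OF bl])
  define b where "b = norm B + 1"
  have b: "b > 0" by (simp add: b_def add_nonneg_pos)
  have up: "norm (G u) \<le> b * norm u" for u
    using norm_blinfun[of B u] mult_right_mono[of "norm B" b "norm u"] by (simp add: B b_def)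
  define D where "D = id_blinfun - (1 / b\<^sup>2) *\<^sub>R (B o\<^sub>L B)"
  have D: "D u = u - (1 / b\<^sup>2) *\<^sub>R G (G u)" for u
    by (simp add: D_def blinfun.diff_left blinfun.scaleR_left B)
  have symD: "symmetric D"
    by (simp add: symmetric_def D cinner_expand symmetricD[OF sym])
  have form: "Re (cinner (D u) u) = (norm u)\<^sup>2 - (norm (G u))\<^sup>2 / b\<^sup>2" for u
    by (simp add: D cinner_expand cinner_self symmetricD[OF sym, of "G u"] flip: of_real_power of_real_divide)
  \<comment> \<open>The maximum with 0 matters in the trivial space, where \<open>\<epsilon>\<close>
    may exceed \<open>b\<close>.\<close>
  define M where "M = max 0 (1 - \<epsilon>\<^sup>2 / b\<^sup>2)"
  have "norm D \<le> M"
  proof (rule norm_le_if_form_le[OF symD])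
    fix u
    have "(norm (G u))\<^sup>2 \<le> (b * norm u)\<^sup>2" by (rule power_mono[OF up]) simp
    then show "0 \<le> Re (cinner (D u) u)" using b by (simp add: form field_simps)
    have "(\<epsilon> * norm u)\<^sup>2 \<le> (norm (G u))\<^sup>2" using \<epsilon> by (intro power_mono below) simp
    then have "Re (cinner (D u) u) \<le> (1 - \<epsilon>\<^sup>2 / b\<^sup>2) * (norm u)\<^sup>2"
      using b by (simp add: form field_simps)
    also have "\<dots> \<le> M * (norm u)\<^sup>2" by (intro mult_right_mono) (simp_all add: M_def)
    finally show "Re (cinner (D u) u) \<le> M * (norm u)\<^sup>2" .
  qed (simp add: M_def)
  moreover have M: "0 \<le> M" "M < 1" using \<epsilon> b by (simp_all add: M_def)
  ultimately have "norm (D u) \<le> M * norm u" for u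
    using norm_blinfun[of D u] mult_right_mono[of "norm D" M "norm u"] by simp
  then have contr: "\<forall>x y. dist (v + D x) (v + D y) \<le> M * dist x y" for v
    by (simp add: dist_norm flip: blinfun.diff_right)
  have "\<exists>x. G x = v" for v
  proof -
    obtain x where "v + D x = x" using banach_fix_type[OF M contr] by metis
    then have "v = (1 / b\<^sup>2) *\<^sub>R G (G x)" by (simp add: D)
    also have "\<dots> = G ((1 / b\<^sup>2) *\<^sub>R G x)"
      by (simp add: clinear_scaleR[OF symmetric_imp_clinear[OF sym]])
    finally show ?thesis by metis
  qed
  then show ?thesis by (metis surjI)
qed

section \<open>Uniqueness of the closure\<close>

locale semibounded_operator = invertible_self_adjoint +
  fixes \<sigma> c :: real
  assumes \<sigma>: "\<sigma> * \<sigma> = 1" and c: "0 \<le> c"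
    and bound: "x \<in> dom T \<Longrightarrow> (norm x)\<^sup>2 \<le> \<sigma> * Re (cinner (the (T x)) x) + c * (norm x)\<^sup>2"
begin

definition B :: "'a \<Rightarrow> 'a" where "B x = \<sigma> *\<^sub>R the (T x) + c *\<^sub>R x"

definition E :: "'a \<Rightarrow> real" where "E x = sqrt (Re (cinner (B x) x))"

lemma norm_le_B: "x \<in> dom T \<Longrightarrow> (norm x)\<^sup>2 \<le> Re (cinner (B x) x)"
  using bound[of x] by (simp add: B_def cinner_expand cinner_self)

lemma B_symmetric: "x \<in> dom T \<Longrightarrow> y \<in> dom T \<Longrightarrow> cinner (B x) y = cinner x (B y)"
  by (simp add: B_def cinner_expand T_symmetric)

lemma norm_le_norm_B:
  assumes "x \<in> dom T" shows "norm x \<le> norm (B x)"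
proof (cases "x = 0")
  case False
  have "norm x * norm x \<le> norm (B x) * norm x"
    using norm_le_B[OF assms] complex_Re_le_cmod[of "cinner (B x) x"] cmod_cinner_le[of "B x" x]
    by (simp add: power2_eq_square)
  then show ?thesis using False by simp
qed simp

text \<open>Composition with \<open>S\<close> turns the unbounded \<open>B\<close> into the bounded
  symmetric \<open>G\<close>, whose surjectivity suffices. The lower bound of \<open>G\<close> comes
  from solving \<open>G u\<close> for \<open>u\<close> and from
  \<open>norm (S u) \<le> norm (G u)\<close>; hence the constant \<open>1 / (1 + c)\<close>.\<close>

lemma B_surj: "\<exists>r\<in>dom T. B r = v \<and> norm r \<le> norm v"
proof -
  define G where "G u = \<sigma> *\<^sub>R u + c *\<^sub>R S u" for u
  have BS: "B (S u) = G u" for u by (simp add: B_def G_def)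
  have "\<bar>\<sigma>\<bar> = 1" using \<sigma> by (metis abs_mult abs_1 abs_mult_self_eq power2_eq_1_iff power2_eq_square abs_minus_cancel)
  have below: "1 / (1 + c) * norm u \<le> norm (G u)" for u
  proof -
    have "norm (S u) \<le> norm (G u)" using norm_le_norm_B[of "S u"] by (simp add: BS)
    moreover have "norm u \<le> norm (G u) + c * norm (S u)"
      using norm_triangle_ineq4[of "G u" "c *\<^sub>R S u"] \<open>\<bar>\<sigma>\<bar> = 1\<close> c by (simp add: G_def)
    ultimately have "norm u \<le> norm (G u) + c * norm (G u)"
      using c mult_left_mono[of "norm (S u)" "norm (G u)" c] by linarith
    then show ?thesis using c by (simp add: field_simps)
  qed
  have "surj G"
  proof (rule symmetric_bounded_below_surj[OF _ _ _ below])
    show "bounded_linear G" unfolding G_def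
      by (intro bounded_linear_add bounded_linear_scaleR_right bounded_linear_const_scaleR bounded_linear_ident bounded_linear_S)
    show "symmetric G" by (simp add: symmetric_def G_def cinner_expand S_symmetric)
  qed (use c in simp)
  then obtain u where "G u = v" by (metis surjD)
  then show ?thesis using BS[of u] norm_le_norm_B[of "S u"] S_in by metis
qed

text \<open>No closure enters here, so the domains and values of any two closures can be described
  by the same sequences.\<close>

definition E_Cauchy :: "(nat \<Rightarrow> 'a) \<Rightarrow> bool" where
  "E_Cauchy s \<longleftrightarrow> (\<forall>n. s n \<in> dom T) \<and> (\<forall>e>0. \<exists>N. \<forall>m\<ge>N. \<forall>n\<ge>N. E (s m - s n) < e)"

text \<open>The lower bound of E rests on writing \<open>ip y (J y)\<close> as \<open>f y z\<close>, where z is obtained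
  from \<open>J y\<close> by means of the inverse of B.\<close>

lemma closure_characterization:
  assumes "(D, t) \<in> \<M> T"
  shows "x \<in> D \<longleftrightarrow> (\<exists>s. E_Cauchy s \<and> s \<longlonglongrightarrow> x)"
    and "x \<in> D \<Longrightarrow> y \<in> D \<Longrightarrow> E_Cauchy s \<Longrightarrow> s \<longlonglongrightarrow> x \<Longrightarrow> E_Cauchy r \<Longrightarrow> r \<longlonglongrightarrow> y \<Longrightarrow>
      (\<lambda>n. cinner (the (T (s n))) (r n)) \<longlonglongrightarrow> t x y"
proof -
  obtain l where gap: "gap_point (D, t) l" and ext: "form_extends (operator_form T) (D, t)"
    and dens: "krein_topology D (shift_form l t) closure_of (dom T) = D"
    using assms unfolding closures_of_operator_form_def form_closure_def by (auto simp: operator_form_simps)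
  have sub: "dom T \<subseteq> D" and tT: "\<And>x y. x \<in> dom T \<Longrightarrow> y \<in> dom T \<Longrightarrow> t x y = cinner (the (T x)) y"
    using ext by (auto simp: form_extends_def operator_form_def)
  have sD: "x \<in> D" if "x \<in> dom T" for x using that sub by blast
  define ip where "ip = shift_form l t"
  have ip: "ip x y = t x y - of_real l * cinner x y" for x y by (simp add: ip_def shift_form_def)
  have kr: "krein_space D ip" and ce: "continuously_embedded D ip"
    using gap by (auto simp: gap_point_def ip_def)
  obtain Kp Km J where "krein_form D Kp Km ip J"
    and top: "krein_topology D ip = Metric_space.mtopology D (ip_dist D (\<lambda>x y. ip (J x) y))"
    by (rule krein_space_obtains[OF kr])
  then interpret krein_form D Kp Km ip J by simp
  obtain C where C: "C > 0" "\<And>x. x \<in> D \<Longrightarrow> norm x \<le> C * H.hnorm x"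
    using H.continuous_embedding_bound ce unfolding continuously_embedded_def top by blast
  have lim_norm: "s \<longlonglongrightarrow> x" if "\<And>n. s n \<in> D" "x \<in> D" "(\<lambda>n. H.hnorm (s n - x)) \<longlonglongrightarrow> 0" for s x
  proof -
    have "(\<lambda>n. s n - x) \<longlonglongrightarrow> 0"
      by (rule Lim_null_comparison[OF always_eventually tendsto_mult_right_zero[OF that(3), of C]])
        (use that C in simp)
    then show ?thesis by (rule LIM_zero_cancel)
  qed
  have seq: "\<exists>s. (\<forall>n. s n \<in> dom T) \<and> (\<lambda>n. H.hnorm (s n - x)) \<longlonglongrightarrow> 0" if x: "x \<in> D" for x
  proof -
    have "x \<in> H.M.mtopology closure_of dom T" using x dens top by (simp add: ip_def)
    then show ?thesis using H.closure_of_sequence[OF sub] by metis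
  qed
  \<comment> \<open>The closure is known to agree with the form of \<open>T\<close> only on
    \<open>dom T\<close>; approximating the second argument in the Krein norm extends the identity
    to \<open>D\<close>.\<close>
  have ip_T: "ip y w = cinner (the (T y)) w - of_real l * cinner y w" if y: "y \<in> dom T" and w: "w \<in> D" for y w
  proof -
    obtain s where s: "\<And>n. s n \<in> dom T" "(\<lambda>n. H.hnorm (s n - w)) \<longlonglongrightarrow> 0" using seq[OF w] by blast
    have "(\<lambda>n. ip y (s n)) \<longlonglongrightarrow> ip y w"
      by (rule ip_tendsto) (use s y w sD in auto)
    moreover have "(\<lambda>n. ip y (s n)) \<longlonglongrightarrow> cinner (the (T y)) w - of_real l * cinner y w"
      unfolding ip tT[OF y s(1)]
      by (intro tendsto_intros bounded_bilinear.tendsto[OF bounded_bilinear_cinner] lim_norm) (use s w sD in auto)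
    ultimately show ?thesis by (rule LIMSEQ_unique)
  qed
  \<comment> \<open>The shift by \<open>l\<close> is undone and the form of \<open>B\<close>
    obtained on all of \<open>D\<close>. Density of \<open>dom T\<close> makes it semidefinite
    there.\<close>
  define f where "f x y = of_real \<sigma> * ip x y + of_real (\<sigma> * l + c) * cinner x y" for x y
  have fB: "f y w = cinner (B y) w" if "y \<in> dom T" "w \<in> D" for y w
    by (simp add: f_def ip_T[OF that] B_def cinner_expand algebra_simps)
  interpret F: semidefinite_form D f
  proof
    show "csubspace D" by (rule K.subspace_V)
    show "hermitian_on D f"
      unfolding hermitian_on_def
    proof (intro conjI ballI allI)
      fix x y assume "x \<in> D" "y \<in> D"
      then show "f y x = cnj (f x y)"
        unfolding f_def using K.commute[of x y] cinner_commute[of y x] by simp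
    qed (simp_all add: f_def K.expand cinner_expand algebra_simps)
    fix x assume x: "x \<in> D"
    obtain s where s: "\<And>n. s n \<in> dom T" "(\<lambda>n. H.hnorm (s n - x)) \<longlonglongrightarrow> 0" using seq[OF x] by blast
    have "(\<lambda>n. f (s n) (s n)) \<longlonglongrightarrow> f x x"
      unfolding f_def
      by (intro tendsto_intros ip_tendsto bounded_bilinear.tendsto[OF bounded_bilinear_cinner] lim_norm) (use s x sD in auto)
    then have "(\<lambda>n. Re (f (s n) (s n))) \<longlonglongrightarrow> Re (f x x)" by (rule tendsto_Re)
    moreover have "0 \<le> Re (f (s n) (s n))" for n
      using norm_le_B[OF s(1)[of n]] fB[OF s(1) sD[OF s(1)], of n n] by (smt (verit) zero_le_power2)
    ultimately show "0 \<le> Re (f x x)" by (intro LIMSEQ_le_const) auto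
  qed
  have EF: "E y = F.hnorm y" if "y \<in> dom T" for y
    using that by (simp add: E_def F.hnorm_def fB sD)
  \<comment> \<open>The first summand bounds \<open>ip\<close> by Cauchy-Schwarz in the Krein space,
    the second bounds \<open>cinner\<close> by the embedding constant \<open>C\<close>.\<close>
  define K1 where "K1 = sqrt (1 + \<bar>\<sigma> * l + c\<bar> * C\<^sup>2)"
  have \<sigma>1: "\<bar>\<sigma>\<bar> = 1" using \<sigma> by (metis abs_mult abs_1 abs_mult_self_eq power2_eq_1_iff power2_eq_square abs_minus_cancel)
  have K1sq: "K1\<^sup>2 = 1 + \<bar>\<sigma> * l + c\<bar> * C\<^sup>2"
    unfolding K1_def by (rule real_sqrt_pow2) simp
  have upper: "F.hnorm x \<le> K1 * H.hnorm x" if x: "x \<in> D" for x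
  proof (rule power2_le_imp_le)
    have "Re (f x x) \<le> cmod (f x x)" by (rule complex_Re_le_cmod)
    also have "\<dots> \<le> cmod (of_real \<sigma> * ip x x) + cmod (of_real (\<sigma> * l + c) * cinner x x)"
      unfolding f_def by (rule norm_triangle_ineq)
    also have "\<dots> = cmod (ip x x) + \<bar>\<sigma> * l + c\<bar> * (norm x)\<^sup>2"
      by (simp only: norm_mult norm_of_real \<sigma>1 cinner_self) simp
    also have "\<dots> \<le> H.hnorm x * H.hnorm x + \<bar>\<sigma> * l + c\<bar> * (C * H.hnorm x)\<^sup>2"
      by (intro add_mono mult_left_mono power_mono Cauchy_Schwarz_ip x C) simp_all
    also have "\<dots> = (K1 * H.hnorm x)\<^sup>2"
      by (simp only: power_mult_distrib K1sq) (simp add: algebra_simps power2_eq_square)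
    finally show "(F.hnorm x)\<^sup>2 \<le> (K1 * H.hnorm x)\<^sup>2" by (simp add: F.hnorm_power2 x)
  qed (use x in \<open>simp add: K1_def\<close>)
  define K2 where "K2 = K1 + \<bar>l + c * \<sigma>\<bar> * C"
  have lower: "H.hnorm y \<le> K2 * E y" if y: "y \<in> dom T" for y
  proof (cases "y = 0")
    case True
    then show ?thesis by (simp add: E_def)
  next
    case False
    then have p: "H.hnorm y > 0" using sD[OF y] H.hnorm_eq_0_iff[of y] H.hnorm_nonneg[of y] by linarith
    define w where "w = J y"
    have wD: "w \<in> D" using sD[OF y] by (simp add: w_def)
    have nw: "H.hnorm w = H.hnorm y" using sD[OF y] by (simp add: w_def hnorm_J)
    obtain r where r: "r \<in> dom T" "B r = w" "norm r \<le> norm w" using B_surj by blast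
    \<comment> \<open>Since \<open>B r = w\<close>, the correction by \<open>r\<close> contributes
      \<open>(l + c * \<sigma>)\<close> times \<open>cinner y w\<close>. Subtracted from
      \<open>\<sigma>\<close> times \<open>cinner (B y) w\<close>, it leaves exactly
      \<open>ip y w\<close>.\<close>
    define z where "z = \<sigma> *\<^sub>R w - (l + c * \<sigma>) *\<^sub>R r"
    have zD: "z \<in> D" using wD sD[OF r(1)] by (simp add: z_def)
    have "f y z = of_real \<sigma> * cinner (B y) w - of_real (l + c * \<sigma>) * cinner y w"
      using fB[OF y zD] B_symmetric[OF y r(1)] by (simp add: z_def cinner_expand r(2))
    also have "of_real \<sigma> * cinner (B y) w = of_real (\<sigma> * \<sigma>) * cinner (the (T y)) w + of_real (c * \<sigma>) * cinner y w"
      by (simp add: B_def cinner_expand algebra_simps)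
    finally have "f y z = ip y w" by (simp add: \<sigma> ip_T[OF y wD] algebra_simps)
    moreover have "ip y w = ip (J y) y" using J_symmetric[OF sD[OF y] sD[OF y]] by (simp add: w_def)
    ultimately have "(H.hnorm y)\<^sup>2 = Re (f y z)" using sD[OF y] by (simp add: H.hnorm_power2)
    also have "\<dots> \<le> F.hnorm y * F.hnorm z"
      using F.Cauchy_Schwarz[OF sD[OF y] zD] complex_Re_le_cmod order_trans by blast
    also have "F.hnorm z \<le> K2 * H.hnorm y"
    proof -
      have rw: "F.hnorm r \<le> norm w"
      proof (rule power2_le_imp_le)
        have "(F.hnorm r)\<^sup>2 = Re (cinner w r)"
          using r sD[OF r(1)] by (simp add: F.hnorm_power2 fB)
        also have "\<dots> \<le> norm w * norm r" using cmod_cinner_le complex_Re_le_cmod order_trans by blast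
        also have "\<dots> \<le> (norm w)\<^sup>2" using r(3) by (simp add: power2_eq_square mult_left_mono)
        finally show "(F.hnorm r)\<^sup>2 \<le> (norm w)\<^sup>2" .
      qed simp
      have "F.hnorm z \<le> F.hnorm (\<sigma> *\<^sub>R w) + F.hnorm (- ((l + c * \<sigma>) *\<^sub>R r))"
        using F.hnorm_triangle[of "\<sigma> *\<^sub>R w" "- ((l + c * \<sigma>) *\<^sub>R r)"] wD sD[OF r(1)] by (simp add: z_def)
      also have "\<dots> = F.hnorm w + \<bar>l + c * \<sigma>\<bar> * F.hnorm r"
        using wD sD[OF r(1)] by (simp add: F.hnorm_minus F.hnorm_scaleR \<sigma>1)
      also have "\<dots> \<le> K1 * H.hnorm w + \<bar>l + c * \<sigma>\<bar> * (C * H.hnorm w)"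
        by (intro add_mono mult_left_mono upper wD order_trans[OF rw C(2)]) simp
      finally show ?thesis by (simp add: K2_def nw algebra_simps)
    qed
    finally have "H.hnorm y * H.hnorm y \<le> (K2 * F.hnorm y) * H.hnorm y"
      using sD[OF y] by (simp add: power2_eq_square mult_left_mono mult_right_mono mult_ac)
    then show ?thesis using p by (simp add: EF[OF y])
  qed
  have K1p: "K1 > 0" by (simp add: K1_def add_pos_nonneg)
  have K2p: "K2 > 0" using K1p C(1) by (simp add: K2_def add_pos_nonneg)
  have dT: "x - y \<in> dom T" if "x \<in> dom T" "y \<in> dom T" for x y
    by (rule complex_vector.subspace_diff[OF subspace_dom that])
  \<comment> \<open>By \<open>lower\<close> such a sequence is Cauchy in the Krein norm. The
    embedding identifies its limit there with the limit in the ambient space, so the latter decides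
    membership in \<open>D\<close>.\<close>
  have Cauchy_lim: "\<exists>a\<in>D. (\<lambda>n. H.hnorm (s n - a)) \<longlonglongrightarrow> 0 \<and> s \<longlonglongrightarrow> a" if s: "E_Cauchy s" for s
  proof -
    have sT: "s n \<in> dom T" for n using s by (simp add: E_Cauchy_def)
    have "\<exists>N. \<forall>m\<ge>N. \<forall>n\<ge>N. H.hnorm (s m - s n) < e" if e: "e > 0" for e
    proof -
      obtain N where N: "\<forall>m\<ge>N. \<forall>n\<ge>N. E (s m - s n) < e / K2"
        using s e K2p unfolding E_Cauchy_def by (meson divide_pos_pos)
      have "H.hnorm (s m - s n) < e" if "m \<ge> N" "n \<ge> N" for m n
      proof -
        have "K2 * E (s m - s n) < e" using N that K2p by (simp add: field_simps)
        then show ?thesis using lower[OF dT[OF sT sT], of m n] by linarith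
      qed
      then show ?thesis by blast
    qed
    then obtain a where a: "a \<in> D" "(\<lambda>n. H.hnorm (s n - a)) \<longlonglongrightarrow> 0"
      using H.complete[of s] sD[OF sT] by blast
    moreover have "s \<longlonglongrightarrow> a" by (rule lim_norm[OF sD[OF sT] a])
    ultimately show ?thesis by blast
  qed
  show "x \<in> D \<longleftrightarrow> (\<exists>s. E_Cauchy s \<and> s \<longlonglongrightarrow> x)"
  proof
    assume x: "x \<in> D"
    obtain s where s: "\<And>n. s n \<in> dom T" "(\<lambda>n. H.hnorm (s n - x)) \<longlonglongrightarrow> 0" using seq[OF x] by blast
    have "\<exists>N. \<forall>m\<ge>N. \<forall>n\<ge>N. E (s m - s n) < e" if e: "e > 0" for e
    proof -
      have "e / (2 * K1) > 0" using e K1p by simp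
      from order_tendstoD(2)[OF s(2) this] obtain N where N: "\<And>n. n \<ge> N \<Longrightarrow> H.hnorm (s n - x) < e / (2 * K1)"
        by (auto simp: eventually_sequentially)
      have "E (s m - s n) < e" if "m \<ge> N" "n \<ge> N" for m n
      proof -
        have "E (s m - s n) \<le> K1 * H.hnorm (s m - s n)"
          using upper[of "s m - s n"] sD s(1) by (simp add: EF[OF dT[OF s(1) s(1)]])
        also have "\<dots> \<le> K1 * (H.hnorm (s m - x) + H.hnorm (s n - x))"
          using H.hnorm_triangle[of "s m - x" "x - s n"] x sD s(1) K1p
          by (intro mult_left_mono) (simp_all add: H.hnorm_diff_commute[of x])
        also have "\<dots> < K1 * (e / (2 * K1) + e / (2 * K1))"
          using N that K1p by (intro mult_strict_left_mono add_strict_mono) auto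
        also have "\<dots> = e" using K1p by (simp add: field_simps)
        finally show ?thesis .
      qed
      then show ?thesis by blast
    qed
    then have "E_Cauchy s" using s(1) by (simp add: E_Cauchy_def)
    moreover have "s \<longlonglongrightarrow> x" by (rule lim_norm[OF sD[OF s(1)] x s(2)])
    ultimately show "\<exists>s. E_Cauchy s \<and> s \<longlonglongrightarrow> x" by blast
  next
    assume "\<exists>s. E_Cauchy s \<and> s \<longlonglongrightarrow> x"
    then show "x \<in> D" using Cauchy_lim LIMSEQ_unique by metis
  qed
  assume xy: "x \<in> D" "y \<in> D" and s: "E_Cauchy s" "s \<longlonglongrightarrow> x" and r: "E_Cauchy r" "r \<longlonglongrightarrow> y"
  have sT: "s n \<in> dom T" and rT: "r n \<in> dom T" for n using s r by (simp_all add: E_Cauchy_def)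
  have sx: "(\<lambda>n. H.hnorm (s n - x)) \<longlonglongrightarrow> 0" using Cauchy_lim[OF s(1)] LIMSEQ_unique[OF s(2)] by blast
  have ry: "(\<lambda>n. H.hnorm (r n - y)) \<longlonglongrightarrow> 0" using Cauchy_lim[OF r(1)] LIMSEQ_unique[OF r(2)] by blast
  have "(\<lambda>n. ip (s n) (r n) + of_real l * cinner (s n) (r n)) \<longlonglongrightarrow> ip x y + of_real l * cinner x y"
    by (intro tendsto_intros ip_tendsto[OF _ xy(1) sx _ xy(2) ry]
        bounded_bilinear.tendsto[OF bounded_bilinear_cinner] s r sD sT rT)
  then show "(\<lambda>n. cinner (the (T (s n))) (r n)) \<longlonglongrightarrow> t x y"
    by (simp add: ip tT sT rT)
qed

lemma closure_unique:
  assumes M: "(D, t) \<in> \<M> T" and M': "(D', t') \<in> \<M> T"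
  shows "(D, t) = (D', t')"
proof -
  have D: "D = D'"
    using closure_characterization(1)[OF M] closure_characterization(1)[OF M'] by blast
  have z: "zero_outside D t" "zero_outside D' t'"
    using M M' by (auto simp: closures_of_operator_form_def form_closure_def closed_form_def is_form_def)
  have "t x y = t' x y" for x y
  proof (cases "x \<in> D \<and> y \<in> D")
    case True
    then obtain s r where "E_Cauchy s" "s \<longlonglongrightarrow> x" "E_Cauchy r" "r \<longlonglongrightarrow> y"
      using closure_characterization(1)[OF M] by meson
    then show ?thesis
      using closure_characterization(2)[OF M] closure_characterization(2)[OF M'] True D LIMSEQ_unique by blast
  next
    case False
    then show ?thesis using z D by (simp add: zero_outside_def)
  qed
  then show ?thesis using D by blast
qed

end

lemma (in invertible_self_adjoint) closure_unique_if_semibounded: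
  assumes "semibounded T" and M: "k \<in> \<M> T" "k' \<in> \<M> T"
  shows "k = k'"
proof -
  have "\<exists>\<sigma> c. semibounded_operator T \<sigma> c"
  proof (cases "semibounded_below T")
    case True
    then obtain b where b: "\<And>x. x \<in> dom T \<Longrightarrow> b * (norm x)\<^sup>2 \<le> Re (cinner (the (T x)) x)"
      by (auto simp: semibounded_below_def)
    \<comment> \<open>\<open>\<bar>b\<bar>\<close> compensates the bound \<open>b\<close> whatever
      its sign, and the summand 1 leaves the squared norm.\<close>
    have "semibounded_operator T 1 (\<bar>b\<bar> + 1)"
    proof unfold_locales
      fix x assume x: "x \<in> dom T"
      have "0 \<le> (b + \<bar>b\<bar>) * (norm x)\<^sup>2" by (intro mult_nonneg_nonneg) auto
      then show "(norm x)\<^sup>2 \<le> 1 * Re (cinner (the (T x)) x) + (\<bar>b\<bar> + 1) * (norm x)\<^sup>2"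
        using b[OF x] by (simp add: algebra_simps)
    qed auto
    then show ?thesis by blast
  next
    case False
    then obtain b where b: "\<And>x. x \<in> dom T \<Longrightarrow> Re (cinner (the (T x)) x) \<le> b * (norm x)\<^sup>2"
      using assms by (auto simp: semibounded_def semibounded_above_def)
    have "semibounded_operator T (-1) (\<bar>b\<bar> + 1)"
    proof unfold_locales
      fix x assume x: "x \<in> dom T"
      have "0 \<le> (\<bar>b\<bar> - b) * (norm x)\<^sup>2" by (intro mult_nonneg_nonneg) auto
      then show "(norm x)\<^sup>2 \<le> -1 * Re (cinner (the (T x)) x) + (\<bar>b\<bar> + 1) * (norm x)\<^sup>2"
        using b[OF x] by (simp add: algebra_simps)
    qed auto
    then show ?thesis by blast
  qed
  then obtain \<sigma> c where "semibounded_operator T \<sigma> c" by blast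
  then interpret semibounded_operator T \<sigma> c .
  show ?thesis using closure_unique M by (cases k; cases k') blast
qed

theorem theorem5p9:
  fixes T :: "'a::complex_hilbert \<rightharpoonup> 'a"
  assumes "self_adjoint T" and "boundedly_invertible T"
  shows "((\<exists>!t. t \<in> \<M> T) \<longleftrightarrow> semibounded T) \<and>
         ((\<exists>!k. k \<in> \<N> T) \<longleftrightarrow> semibounded T)"
proof -
  interpret invertible_self_adjoint T by (rule invertible_self_adjoint.intro[OF assms])
  obtain K ip A where N: "(K, ip, A) \<in> \<N> T" using completion_exists by (metis prod_cases3)
  show ?thesis
  proof (cases "semibounded T")
    case True
    note uniq = closure_unique_if_semibounded[OF True]
    have "\<exists>!t. t \<in> \<M> T" using closure_if_completion[OF N] uniq by blast
    moreover have "k = (K, ip, A)" if k: "k \<in> \<N> T" for k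
    proof -
      obtain K' ip' A' where k': "k = (K', ip', A')" by (cases k)
      have "(K', ip') = (K, ip)"
        using uniq closure_if_completion[OF N] closure_if_completion[of K' ip' A'] k k' by blast
      \<comment> \<open>The operator of a triple is determined by its space, so equal spaces and
        forms give equal triples.\<close>
      then show ?thesis using k N k' by (simp add: completions_of_operator_form_def)
    qed
    then have "\<exists>!k. k \<in> \<N> T" using N by blast
    ultimately show ?thesis using True by blast
  next
    case False
    obtain K ip A K' ip' A' where *: "(K, ip, A) \<in> \<N> T" "(K', ip', A') \<in> \<N> T" "K \<noteq> K'"
      by (rule distinct_completions[OF False])
    have "\<not> (\<exists>!k. k \<in> \<N> T)" using * by blast
    moreover have "\<not> (\<exists>!t. t \<in> \<M> T)"
      using closure_if_completion[OF *(1)] closure_if_completion[OF *(2)] *(3) by blast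
    ultimately show ?thesis using False by blast
  qed
qed

end
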